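(* Let $G$ be a bridgeless bipartite graph that is not $2$-simultaneous edge colorable, chosen so that $|E(G)|$ is minimum among all bridgeless bipartite graphs that are not $2$-simultaneous edge colorable, and, subject to this, $|V(G)|$ is maximum. Then: (i) $G$ is $2$-connected; (ii) $\delta(G)=2$ and $\Delta(G)=3$; (iii) $G$ has no nontrivial edge cut of size $2$; (iv) for each vertex $v$ with $\deg(v)=2$, the graph $G-v$ is bridgeless; (v) for each vertex $v$ with $N(v)=\{u,w\}$, we have $N(u)\cap N(w)=\{v\}$.
   Context: All graphs are finite and simple; $[l]=\{1,\ldots,l\}$. For a nonempty proper subset $S\subset V(G)$, the edge cut $[S,\overline S]$ is the set of edges with one end in $S$ and one in $V(G)\setminus S$; the edge connectivity $\kappa'(G)$ is the minimum size of an edge cut, and "bridgeless" means $2$-edge-connected, i.e. $\kappa'(G)\ge 2$ (in particular connected). An edge cut $F$ is trivial if some component of $G\setminus F$ is an isolated vertex. A $2$-simultaneous edge coloring of $G$ is a pair $(c_1,c_2)$ of proper edge colorings $c_i:E(G)\to[l]$ with a common color set such that for every vertex $v$ the sets of colors on edges incident to $v$ are the same under $c_1$ and $c_2$, and $c_1(e)\ne c_2(e)$ for every edge $e$; $G$ is $2$-simultaneous edge colorable if such a pair exists for some $l$. $\delta,\Delta$ denote minimum and maximum degree, $N(v)$ the neighbourhood of $v$. *)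

theory Defs
  imports Main
begin

record 'a ugraph =
  verts :: "'a set"
  edges :: "'a set set"

definition simple_graph :: "'a ugraph \<Rightarrow> bool" where
  "simple_graph G \<longleftrightarrow> finite (verts G) \<and> (\<forall>e\<in>edges G. e \<subseteq> verts G \<and> card e = 2)"

definition incident_edges :: "'a ugraph \<Rightarrow> 'a \<Rightarrow> 'a set set" where
  "incident_edges G v = {e \<in> edges G. v \<in> e}"

definition degree :: "'a ugraph \<Rightarrow> 'a \<Rightarrow> nat" where
  "degree G v = card (incident_edges G v)"

definition min_degree :: "'a ugraph \<Rightarrow> nat" where
  "min_degree G = Min (degree G ` verts G)"

definition max_degree :: "'a ugraph \<Rightarrow> nat" where
  "max_degree G = Max (degree G ` verts G)"

definition neighbourhood :: "'a ugraph \<Rightarrow> 'a \<Rightarrow> 'a set" where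
  "neighbourhood G v = {u \<in> verts G. {v, u} \<in> edges G}"

definition del_verts :: "'a ugraph \<Rightarrow> 'a set \<Rightarrow> 'a ugraph" where
  "del_verts G X = \<lparr>verts = verts G - X, edges = {e \<in> edges G. e \<inter> X = {}}\<rparr>"

definition del_edges :: "'a ugraph \<Rightarrow> 'a set set \<Rightarrow> 'a ugraph" where
  "del_edges G F = \<lparr>verts = verts G, edges = edges G - F\<rparr>"

definition reachable :: "'a ugraph \<Rightarrow> 'a \<Rightarrow> 'a \<Rightarrow> bool" where
  "reachable G = (\<lambda>u v. {u, v} \<in> edges G)\<^sup>*\<^sup>*"

(* Components are represented by their vertex sets. *)
definition components :: "'a ugraph \<Rightarrow> 'a set set" where
  "components G = {{u \<in> verts G. reachable G v u} | v. v \<in> verts G}"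

definition connected :: "'a ugraph \<Rightarrow> bool" where
  "connected G \<longleftrightarrow> verts G \<noteq> {} \<and> (\<forall>u\<in>verts G. \<forall>v\<in>verts G. reachable G u v)"

definition k_connected :: "nat \<Rightarrow> 'a ugraph \<Rightarrow> bool" where
  "k_connected k G \<longleftrightarrow> k < card (verts G) \<and>
     (\<forall>X. X \<subseteq> verts G \<and> card X < k \<longrightarrow> connected (del_verts G X))"

definition bipartite :: "'a ugraph \<Rightarrow> bool" where
  "bipartite G \<longleftrightarrow> (\<exists>A B. A \<union> B = verts G \<and> A \<inter> B = {} \<and>
     (\<forall>e\<in>edges G. \<exists>a\<in>A. \<exists>b\<in>B. e = {a, b}))"

definition cut_edges :: "'a ugraph \<Rightarrow> 'a set \<Rightarrow> 'a set set" where
  "cut_edges G S = {e \<in> edges G. \<exists>a\<in>S. \<exists>b\<in>verts G - S. e = {a, b}}"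

definition edge_cut :: "'a ugraph \<Rightarrow> 'a set set \<Rightarrow> bool" where
  "edge_cut G F \<longleftrightarrow> (\<exists>S. S \<noteq> {} \<and> S \<subset> verts G \<and> F = cut_edges G S)"

definition trivial_edge_cut :: "'a ugraph \<Rightarrow> 'a set set \<Rightarrow> bool" where
  "trivial_edge_cut G F \<longleftrightarrow> edge_cut G F \<and> (\<exists>v. {v} \<in> components (del_edges G F))"

(* A graph with at most one vertex has no edge cut; by the usual convention
   its edge connectivity is 0. *)
definition edge_connectivity :: "'a ugraph \<Rightarrow> nat" where
  "edge_connectivity G =
     (if card (verts G) \<le> 1 then 0 else Min {card F | F. edge_cut G F})"

(* Bridgeless includes connected here: an empty edge cut has size 0. *)
definition bridgeless :: "'a ugraph \<Rightarrow> bool" where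
  "bridgeless G \<longleftrightarrow> edge_connectivity G \<ge> 2"

definition proper_edge_coloring :: "'a ugraph \<Rightarrow> nat \<Rightarrow> ('a set \<Rightarrow> nat) \<Rightarrow> bool" where
  "proper_edge_coloring G l c \<longleftrightarrow> c ` edges G \<subseteq> {1..l} \<and>
     (\<forall>e\<in>edges G. \<forall>f\<in>edges G. e \<noteq> f \<and> e \<inter> f \<noteq> {} \<longrightarrow> c e \<noteq> c f)"

definition two_simultaneous_edge_coloring ::
  "'a ugraph \<Rightarrow> nat \<Rightarrow> ('a set \<Rightarrow> nat) \<Rightarrow> ('a set \<Rightarrow> nat) \<Rightarrow> bool" where
  "two_simultaneous_edge_coloring G l c1 c2 \<longleftrightarrow>
     proper_edge_coloring G l c1 \<and> proper_edge_coloring G l c2 \<and>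
     (\<forall>v\<in>verts G. c1 ` incident_edges G v = c2 ` incident_edges G v) \<and>
     (\<forall>e\<in>edges G. c1 e \<noteq> c2 e)"

definition two_simultaneous_edge_colorable :: "'a ugraph \<Rightarrow> bool" where
  "two_simultaneous_edge_colorable G \<longleftrightarrow>
     (\<exists>l c1 c2. two_simultaneous_edge_coloring G l c1 c2)"

definition bridgeless_bipartite_noncolorable :: "'a ugraph \<Rightarrow> bool" where
  "bridgeless_bipartite_noncolorable G \<longleftrightarrow>
     simple_graph G \<and> bridgeless G \<and> bipartite G \<and> \<not> two_simultaneous_edge_colorable G"

(* HOL cannot quantify over the vertex type inside a formula, so the competing graphs H have
   vertices in nat; every finite graph is isomorphic to such a graph. *)
definition extremal_noncolorable :: "'a ugraph \<Rightarrow> bool" where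
  "extremal_noncolorable G \<longleftrightarrow>
     bridgeless_bipartite_noncolorable G \<and>
     (\<forall>H :: nat ugraph. bridgeless_bipartite_noncolorable H \<longrightarrow>
        card (edges G) \<le> card (edges H)) \<and>
     (\<forall>H :: nat ugraph. bridgeless_bipartite_noncolorable H \<and>
        card (edges H) = card (edges G) \<longrightarrow> card (verts H) \<le> card (verts G))"

end

theory Submission
  imports Defs
begin

text \<open>
  On a bipartite graph a 2-simultaneous edge colouring amounts to an oriented cycle double cover:
  each colour class is a set of directed cycles, and each edge is used once in either direction. Vertex
  multiplicities in a colour class do not matter, since an Eulerian digraph decomposes into cycles.
  Such covers are glued along cut vertices and nontrivial 2-edge cuts, so a minimal counterexample
  has neither, and they survive the identification of two vertices. So a vertex of degree at least
  four could be split by Fleischner's argument (one of two splittings is bridgeless, since otherwise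
  \<open>G - v\<close> would have two crossing one-edge cuts), contradicting the maximality of \<open>\<bar>V\<bar>\<close>.
  Regular bipartite graphs are coloured by a Koenig colouring and its cyclic shift, so both degrees
  2 and 3 occur. If a vertex of degree two lay on a 4-cycle, a cover of \<open>G - v\<close> would
  extend by rerouting one colour.
\<close>

section \<open>Balanced dart colourings\<close>

text \<open>Excess is additive over disjoint edge sets, so every transfer of a colouring to
  \<open>G\<close> is a sum of local contributions that must cancel; no list of cycles is carried
  along. Properness is lost on the way and restored only when a colouring of \<open>G\<close> has to
  contradict noncolourability.

  Minimality speaks only about simple, bipartite, bridgeless graphs. This shapes the reduction at a
  two-edge cut whose ends on one side are \<open>a1\<close> and \<open>a2\<close>: joining them by
  an edge would close that side, but the edge breaks bipartiteness if both ends are in the same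
  class, and is parallel to an old one if they are adjacent. A path of length two replaces it in the
  first case, the recolouring of one dart in the second, and a side that is a single edge is
  coloured by hand. All variants end in the same boundary behaviour \<open>carries\<close>.

  The degree bound 3 is what makes the 4-cycle argument work: among at most three neighbours, a
  fixed-point-free matching of incoming with outgoing colours sends some colour between any two
  given ones. With four neighbours the colours could be exchanged within two disjoint pairs.\<close>

text \<open>A pair \<open>(c\<^sub>1, c\<^sub>2)\<close> of edge colourings of a bipartite graph is encoded as one
  colouring \<open>f\<close> of the darts (ordered pairs of adjacent vertices): \<open>c\<^sub>1\<close> colours the
  darts leaving one side, \<open>c\<^sub>2\<close> those leaving the other. The condition that all excesses vanish
  is weaker than that of a simultaneous colouring, because a colour may enter a vertex several
  times; this makes balanced colourings stable under gluing without renaming colours.\<close>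

definition excess :: "'a set set \<Rightarrow> ('a \<Rightarrow> 'a \<Rightarrow> nat) \<Rightarrow> 'a \<Rightarrow> nat \<Rightarrow> int" where
  "excess E f x i = (\<Sum>u | {u, x} \<in> E. of_bool (f u x = i) - of_bool (f x u = i))"

definition antiparallel_distinct :: "'a set set \<Rightarrow> ('a \<Rightarrow> 'a \<Rightarrow> nat) \<Rightarrow> bool" where
  "antiparallel_distinct E f \<longleftrightarrow> (\<forall>u v. {u, v} \<in> E \<longrightarrow> f u v \<noteq> f v u)"

definition balanced :: "'a set set \<Rightarrow> ('a \<Rightarrow> 'a \<Rightarrow> nat) \<Rightarrow> bool" where
  "balanced E f \<longleftrightarrow> antiparallel_distinct E f \<and> (\<forall>x i. excess E f x i = 0)"

lemma finite_nbrs: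
  assumes "finite E" shows "finite {u. {u, x} \<in> E}"
proof -
  have "inj_on (\<lambda>u. {u, x}) {u. {u, x} \<in> E}"
    by (auto simp: inj_on_def doubleton_eq_iff)
  moreover have "(\<lambda>u. {u, x}) ` {u. {u, x} \<in> E} \<subseteq> E" by auto
  ultimately show ?thesis using assms finite_subset finite_imageD by metis
qed

lemma sum_of_bool_card:
  assumes "finite A"
  shows "(\<Sum>a\<in>A. of_bool (P a)) = int (card {a \<in> A. P a})"
  using sum_of_bool_eq[OF assms assms, of P] by (simp add: Int_def)

lemma sum_of_bool_unique:
  assumes "finite A" "a \<in> A" "P a" "\<And>b. b \<in> A \<Longrightarrow> P b \<Longrightarrow> b = a"
  shows "(\<Sum>b\<in>A. of_bool (P b)) = (1 :: int)"
proof -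
  have "{b \<in> A. P b} = {a}" using assms by blast
  then show ?thesis using sum_of_bool_card[OF assms(1), of P] by simp
qed

lemma finite_edges: "simple_graph G \<Longrightarrow> finite (edges G)"
  unfolding simple_graph_def by (meson Pow_iff finite_Pow_iff finite_subset subsetI)

lemma simple_edgeD:
  assumes "simple_graph G" "{u, v} \<in> edges G"
  shows "u \<in> verts G" "v \<in> verts G" "u \<noteq> v"
  using assms by (auto simp: simple_graph_def card_insert_if split: if_splits)

lemma simple_edgeE:
  assumes "simple_graph G" "e \<in> edges G"
  obtains u v where "e = {u, v}" "u \<noteq> v" "u \<in> verts G" "v \<in> verts G"
  using assms by (auto simp: simple_graph_def card_2_iff)

lemma excess_Un:
  assumes "finite E1" "finite E2" "E1 \<inter> E2 = {}"
  shows "excess (E1 \<union> E2) f x i = excess E1 f x i + excess E2 f x i"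
proof -
  have "{u. {u, x} \<in> E1 \<union> E2} = {u. {u, x} \<in> E1} \<union> {u. {u, x} \<in> E2}" by auto
  moreover have "{u. {u, x} \<in> E1} \<inter> {u. {u, x} \<in> E2} = {}" using assms by auto
  ultimately show ?thesis unfolding excess_def
    using assms by (simp add: finite_nbrs sum.union_disjoint)
qed

lemma excess_cong:
  assumes "\<And>u v. {u, v} \<in> E \<Longrightarrow> f u v = g u v"
  shows "excess E f x i = excess E g x i"
  unfolding excess_def
  by (rule sum.cong) (auto simp: assms insert_commute)

lemma excess_edge:
  assumes "a \<noteq> b"
  shows "excess {{a, b}} f x i =
    (of_bool (x = b) - of_bool (x = a)) * (of_bool (f a b = i) - of_bool (f b a = i))"
proof -
  have "{u. {u, x} \<in> {{a, b}}} = (if x = a then {b} else if x = b then {a} else {})"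
    using assms by (auto simp: doubleton_eq_iff)
  then show ?thesis using assms by (auto simp: excess_def)
qed

text \<open>All comparisons of a modified graph with \<open>G\<close> add edges one at a time by
  this rule, which turns balance into arithmetic of indicators.\<close>

lemma excess_insert:
  assumes "finite E" "{a, b} \<notin> E" "a \<noteq> b"
  shows "excess (insert {a, b} E) f x i = excess E f x i +
    (of_bool (x = b) - of_bool (x = a)) * (of_bool (f a b = i) - of_bool (f b a = i))"
  using excess_Un[of E "{{a, b}}" f x i] excess_edge[of a b f x i] assms by simp

lemma excess_inj:
  assumes "inj \<pi>"
  shows "excess E (\<lambda>u v. \<pi> (f u v)) x (\<pi> i) = excess E f x i"
  using assms by (simp add: excess_def inj_eq)

lemma excess_unused:
  assumes "\<And>u v. {u, v} \<in> E \<Longrightarrow> f u v \<noteq> i"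
  shows "excess E f x i = 0"
  unfolding excess_def using assms by (auto intro!: sum.neutral simp: insert_commute)

lemma balanced_inj:
  assumes "inj \<pi>" "balanced E f"
  shows "balanced E (\<lambda>u v. \<pi> (f u v))"
  unfolding balanced_def
proof (intro conjI allI)
  show "antiparallel_distinct E (\<lambda>u v. \<pi> (f u v))"
    using assms by (auto simp: balanced_def antiparallel_distinct_def inj_eq)
  fix x i
  show "excess E (\<lambda>u v. \<pi> (f u v)) x i = 0"
  proof (cases "i \<in> range \<pi>")
    case True
    then obtain j where "i = \<pi> j" by auto
    then show ?thesis
      using assms(2) excess_inj[OF assms(1), of E f x j] by (simp add: balanced_def)
  next
    case False
    then show ?thesis by (intro excess_unused) auto
  qed
qed

text \<open>Fix one successor \<open>s x\<close> for every tail and take a smallest nonempty set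
  closed under \<open>s\<close>. Its image is closed too, hence equal to it, so \<open>s\<close>
  permutes it. A permutation along arcs is a union of disjoint directed cycles, which is all that
  recolouring needs.\<close>

lemma cycle_in_digraph:
  fixes D :: "('a \<times> 'a) set"
  assumes "finite D" "D \<noteq> {}" "snd ` D \<subseteq> fst ` D"
  obtains s X where "X \<noteq> {}" "finite X" "bij_betw s X X" "\<And>x. x \<in> X \<Longrightarrow> (x, s x) \<in> D"
proof -
  define s where "s x = (SOME y. (x, y) \<in> D)" for x
  have s: "(x, s x) \<in> D" if "x \<in> fst ` D" for x
    using that unfolding s_def by (auto intro: someI)
  define P where "P X \<longleftrightarrow> X \<noteq> {} \<and> X \<subseteq> fst ` D \<and> s ` X \<subseteq> X" for X
  have "s x \<in> fst ` D" if "x \<in> fst ` D" for x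
    using s[OF that] assms(3) imageI[of "(x, s x)" D snd] by auto
  then have "P (fst ` D)" unfolding P_def using assms(2) by blast
  then have "\<exists>X. P X \<and> (\<forall>Y. P Y \<longrightarrow> card X \<le> card Y)"
    by (rule ex_has_least_nat)
  then obtain X where X: "P X" "\<And>Y. P Y \<Longrightarrow> card X \<le> card Y" by auto
  have fin: "finite X" using X(1) assms(1) unfolding P_def by (meson finite_imageI finite_subset)
  have "P (s ` X)" using X(1) unfolding P_def by auto
  then have "card X \<le> card (s ` X)" by (rule X(2))
  then have "s ` X = X" using X(1) fin unfolding P_def by (simp add: card_seteq)
  then have "bij_betw s X X" using fin by (simp add: bij_betw_def eq_card_imp_inj_on)
  moreover have "(x, s x) \<in> D" if "x \<in> X" for x
    using that X(1) by (intro s) (auto simp: P_def)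
  ultimately show thesis using that X(1) fin unfolding P_def by blast
qed

definition colours_used :: "'a set set \<Rightarrow> ('a \<Rightarrow> 'a \<Rightarrow> nat) \<Rightarrow> nat set" where
  "colours_used E f = {f u v | u v. {u, v} \<in> E}"

lemma colours_usedI: "{a, b} \<in> E \<Longrightarrow> f a b \<in> colours_used E f"
  by (auto simp: colours_used_def)

lemma colours_usedE:
  assumes "c \<in> colours_used E f"
  obtains a b where "{a, b} \<in> E" "c = f a b"
  using assms by (auto simp: colours_used_def)

lemma finite_darts:
  assumes "finite E" shows "finite {(u, v). {u, v} \<in> E}"
proof (rule finite_subset)
  show "{(u, v). {u, v} \<in> E} \<subseteq> (\<Union>e\<in>{e \<in> E. finite e}. e \<times> e)" by fastforce
  show "finite (\<Union>e\<in>{e \<in> E. finite e}. e \<times> e)" using assms by simp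
qed

text \<open>The bound does not depend on \<open>f\<close>; it makes a balanced colouring with the
  most colours exist.\<close>

lemma card_colours_used:
  assumes "finite E"
  shows "finite (colours_used E f)" "card (colours_used E f) \<le> card {(u, v). {u, v} \<in> E}"
proof -
  have "colours_used E f = case_prod f ` {(u, v). {u, v} \<in> E}"
    unfolding colours_used_def by auto
  then show "finite (colours_used E f)" "card (colours_used E f) \<le> card {(u, v). {u, v} \<in> E}"
    using finite_darts[OF assms] by (auto intro: card_image_le)
qed

text \<open>If a colour leaves \<open>x\<close> twice, then recolouring one directed cycle of that colour
  class with a fresh colour keeps the old colour in use. Hence a balanced colouring with the most
  colours is proper.\<close>

lemma balanced_refine:
  assumes fin: "finite E" and bal: "balanced E f"
    and two: "{x, u} \<in> E" "{x, v} \<in> E" "u \<noteq> v" "f x u = f x v"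
  shows "\<exists>g. balanced E g \<and> card (colours_used E f) < card (colours_used E g)"
proof -
  define i where "i = f x u"
  define D where "D = {(a, b). {a, b} \<in> E \<and> f a b = i}"
  have "finite D" unfolding D_def by (rule finite_subset[OF _ finite_darts[OF fin]]) auto
  moreover have "(x, u) \<in> D" unfolding D_def i_def using two by auto
  moreover have "snd ` D \<subseteq> fst ` D"
  proof (clarsimp)
    fix a b assume ab: "(a, b) \<in> D"
    show "b \<in> fst ` D"
    proof (rule ccontr)
      assume "b \<notin> fst ` D"
      then have no: "\<And>c. {b, c} \<in> E \<Longrightarrow> f b c \<noteq> i" unfolding D_def by force
      \<comment> \<open>Without a leaving dart of colour \<open>i\<close>, the excess at
        \<open>b\<close> only counts entering darts, and the one from \<open>a\<close> makes it
        positive.\<close>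
      have "excess E f b i = (\<Sum>c | {c, b} \<in> E. of_bool (f c b = i))"
        unfolding excess_def by (rule sum.cong) (use no in \<open>auto simp: insert_commute\<close>)
      also have "\<dots> > 0"
        using ab by (intro sum_pos2[of _ a]) (auto simp: D_def finite_nbrs fin)
      finally show False using bal by (simp add: balanced_def)
    qed
  qed
  ultimately obtain s X where X: "X \<noteq> {}" "finite X" "bij_betw s X X"
    "\<And>y. y \<in> X \<Longrightarrow> (y, s y) \<in> D"
    using cycle_in_digraph[of D] by (metis empty_iff)
  obtain k where k: "k \<notin> colours_used E f"
    using card_colours_used[OF fin] ex_new_if_finite infinite_UNIV_nat by blast
  then have k': "f a b \<noteq> k" if "{a, b} \<in> E" for a b
    using that unfolding colours_used_def by auto
  define P where "P a b \<longleftrightarrow> a \<in> X \<and> b = s a" for a b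
  define g where "g a b = (if P a b then k else f a b)" for a b
  have P: "{a, b} \<in> E" "f a b = i" if "P a b" for a b using X(4) that by (auto simp: D_def P_def)
  have dist: "f a b \<noteq> f b a" if "{a, b} \<in> E" for a b
    using bal that by (auto simp: balanced_def antiparallel_distinct_def)
  have "antiparallel_distinct E g"
    unfolding antiparallel_distinct_def
  proof (intro allI impI)
    fix a b assume ab: "{a, b} \<in> E"
    then have "{b, a} \<in> E" by (simp add: insert_commute)
    then show "g a b \<noteq> g b a"
      using dist[OF ab] k'[OF ab] k'[of b a] P(2)[of a b] P(2)[of b a] by (auto simp: g_def)
  qed
  moreover have "excess E g y j = 0" for y j
  proof -
    let ?N = "{a. {a, y} \<in> E}"
    \<comment> \<open>The change in the indicator of colour \<open>j\<close> on a dart recoloured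
      from \<open>i\<close> to \<open>k\<close>. The permutation enters and leaves each vertex of
      \<open>X\<close> exactly once, so the two changes at a vertex cancel.\<close>
    let ?d = "of_bool (j = k) - of_bool (j = i) :: int"
    have inn: "(\<Sum>a\<in>?N. of_bool (P a y)) = (of_bool (y \<in> X) :: int)"
    proof (cases "y \<in> X")
      case True
      then obtain a where a: "P a y" using X(3) unfolding P_def by (metis bij_betw_imp_surj_on imageE)
      have "b = a" if "P b y" for b
        using a that X(3) by (auto simp: P_def bij_betw_def inj_on_def)
      then have "{b \<in> ?N. P b y} = {a}" using a P(1)[OF a] by blast
      then show ?thesis using True unfolding sum_of_bool_card[OF finite_nbrs[OF fin]] by simp
    next
      case False
      then have "\<not> P b y" for b using bij_betwE[OF X(3)] unfolding P_def by blast
      then show ?thesis using False by simp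
    qed
    have out: "(\<Sum>a\<in>?N. of_bool (P y a)) = (of_bool (y \<in> X) :: int)"
    proof (cases "y \<in> X")
      case True
      then have "P y (s y)" "\<And>b. P y b \<Longrightarrow> b = s y" unfolding P_def by auto
      moreover have "{s y, y} \<in> E" using P(1)[OF \<open>P y (s y)\<close>] by (simp add: insert_commute)
      ultimately have "{b \<in> ?N. P y b} = {s y}" by blast
      then show ?thesis using True unfolding sum_of_bool_card[OF finite_nbrs[OF fin]] by simp
    qed (simp add: P_def)
    have gb: "of_bool (g a b = j) = of_bool (f a b = j) + of_bool (P a b) * ?d" for a b
      using P(2)[of a b] by (cases "P a b") (auto simp: g_def)
    have "excess E g y j = (\<Sum>a\<in>?N. (of_bool (f a y = j) - of_bool (f y a = j))
        + (of_bool (P a y) * ?d - of_bool (P y a) * ?d))"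
      unfolding excess_def
      by (rule sum.cong) (simp_all only: gb algebra_simps)
    also have "\<dots> = excess E f y j + ((\<Sum>a\<in>?N. of_bool (P a y)) * ?d
         - (\<Sum>a\<in>?N. of_bool (P y a)) * ?d)"
      unfolding excess_def by (simp only: sum.distrib sum_subtractf sum_distrib_right)
    also have "\<dots> = 0" using bal by (simp only: inn out) (simp add: balanced_def)
    finally show ?thesis .
  qed
  ultimately have "balanced E g" unfolding balanced_def by blast
  moreover have "k \<in> colours_used E g"
  proof -
    obtain y where "y \<in> X" using X(1) by auto
    then have "P y (s y)" unfolding P_def by simp
    then have "{y, s y} \<in> E" "g y (s y) = k" using P(1) by (auto simp: g_def)
    then show ?thesis using colours_usedI[of y "s y" E g] by simp
  qed
  moreover have "c \<in> colours_used E g" if c: "c \<in> colours_used E f" for c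
  proof -
    obtain a b where ab: "{a, b} \<in> E" "c = f a b" by (rule colours_usedE[OF c])
    show ?thesis
    proof (cases "P a b")
      case True
      then have "c = i" using ab P(2) by auto
      \<comment> \<open>At most one of the darts to \<open>u\<close> and \<open>v\<close> follows
        \<open>s\<close>, so the other keeps colour \<open>i\<close>; here the two equally coloured
        darts at \<open>x\<close> are used.\<close>
      moreover have "g x u = i \<or> g x v = i" using two i_def by (auto simp: g_def P_def)
      ultimately show ?thesis
        using colours_usedI[OF two(1), of g] colours_usedI[OF two(2), of g] by auto
    next
      case False
      then have "c = g a b" using ab by (simp add: g_def)
      then show ?thesis using colours_usedI[OF ab(1), of g] by simp
    qed
  qed
  ultimately have "card (insert k (colours_used E f)) \<le> card (colours_used E g)"
    using card_colours_used(1)[OF fin] by (intro card_mono) auto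
  then have "card (colours_used E f) < card (colours_used E g)"
    using k card_colours_used(1)[OF fin] by simp
  with \<open>balanced E g\<close> show ?thesis by blast
qed

lemma balanced_proper:
  assumes fin: "finite E" and bal: "balanced E f"
  obtains g where "balanced E g"
    "\<And>x u v. {x, u} \<in> E \<Longrightarrow> {x, v} \<in> E \<Longrightarrow> g x u = g x v \<Longrightarrow> u = v"
    "\<And>x u v. {u, x} \<in> E \<Longrightarrow> {v, x} \<in> E \<Longrightarrow> g u x = g v x \<Longrightarrow> u = v"
proof -
  let ?m = "\<lambda>h. card (colours_used E h)"
  have "\<forall>h. balanced E h \<longrightarrow> ?m h < Suc (card {(u, v). {u, v} \<in> E})"
    using card_colours_used(2)[OF fin] by (simp add: less_Suc_eq_le)
  with bal have "\<exists>g. balanced E g \<and> (\<forall>h. balanced E h \<longrightarrow> ?m h \<le> ?m g)"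
    by (rule Lattices_Big.ex_has_greatest_nat)
  then obtain g where g: "balanced E g"
    "\<And>h. balanced E h \<Longrightarrow> card (colours_used E h) \<le> card (colours_used E g)" by auto
  have out: "u = v" if "{x, u} \<in> E" "{x, v} \<in> E" "g x u = g x v" for x u v
    using balanced_refine[OF fin g(1), of x u v] that g(2) by (meson not_less)
  \<comment> \<open>Uniqueness of leaving darts passes to entering darts by balance: two entering
    darts of one colour would require two leaving ones.\<close>
  moreover have "u = v" if "{u, x} \<in> E" "{v, x} \<in> E" "g u x = g v x" for x u v
  proof (rule ccontr)
    assume "u \<noteq> v"
    let ?N = "{a. {a, x} \<in> E}"
    let ?i = "g u x"
    have fN: "finite ?N" using finite_nbrs[OF fin] .
    have 1: "(\<Sum>a\<in>?N. of_bool (g a x = ?i)) = (\<Sum>a\<in>?N. of_bool (g x a = ?i) :: int)"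
      using g(1) unfolding balanced_def excess_def sum_subtractf by simp
    have "(2::int) = (\<Sum>a\<in>{u, v}. of_bool (g a x = ?i))" using \<open>u \<noteq> v\<close> that by simp
    also have "\<dots> \<le> (\<Sum>a\<in>?N. of_bool (g a x = ?i))"
      using that fN by (intro sum_mono2) auto
    also have "\<dots> = int (card {a \<in> ?N. g x a = ?i})" unfolding 1
      by (rule sum_of_bool_card[OF fN])
    also have "\<dots> \<le> 1"
    proof -
      have "a = b" if "a \<in> {a \<in> ?N. g x a = ?i}" "b \<in> {a \<in> ?N. g x a = ?i}" for a b
        using that by (intro out) (auto simp: insert_commute)
      then show ?thesis by (simp add: card_le_Suc0_iff_eq fN)
    qed
    finally show False by simp
  qed
  ultimately show thesis using that g(1) by blast
qed

section \<open>Translation between simultaneous and balanced colourings\<close>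

lemma bipartite_edgeE:
  assumes "\<forall>e\<in>edges G. \<exists>a\<in>A. \<exists>b\<in>B. e = {a, b}" "A \<inter> B = {}" "{u, v} \<in> edges G"
  shows "u \<in> A \<and> v \<in> B \<or> u \<in> B \<and> v \<in> A"
  using assms(1)[rule_format, OF assms(3)] by (auto simp: doubleton_eq_iff)

text \<open>Turns equality of colour sets at a vertex into equality of counts and back, since
  properness lets each colour occur there at most once.\<close>

lemma proper_coloring_count:
  assumes "simple_graph G" "proper_edge_coloring G l c" "x \<in> verts G"
  shows "(\<Sum>u | {u, x} \<in> edges G. of_bool (c {u, x} = i)) =
    (of_bool (i \<in> c ` incident_edges G x) :: int)"
proof -
  let ?N = "{u. {u, x} \<in> edges G}"
  have fN: "finite ?N" by (rule finite_nbrs[OF finite_edges[OF assms(1)]])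
  show ?thesis
  proof (cases "i \<in> c ` incident_edges G x")
    case True
    then obtain e where e: "e \<in> edges G" "x \<in> e" "c e = i" by (auto simp: incident_edges_def)
    obtain a b where "e = {a, b}" using simple_edgeE[OF assms(1) e(1)] .
    then obtain u where u: "e = {u, x}" using e(2) by (auto simp: doubleton_eq_iff)
    have un: "v = u" if v: "{v, x} \<in> edges G" "c {v, x} = i" for v
    proof (rule ccontr)
      assume "v \<noteq> u"
      then have "{v, x} \<noteq> {u, x}" by (auto simp: doubleton_eq_iff)
      moreover have "{v, x} \<inter> {u, x} \<noteq> {}" by auto
      ultimately have "c {v, x} \<noteq> c {u, x}"
        using assms(2) v(1) e(1) u unfolding proper_edge_coloring_def by simp
      then show False using v(2) e(3) u by simp
    qed
    have "(\<Sum>v\<in>?N. of_bool (c {v, x} = i)) = (1 :: int)"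
    proof (rule sum_of_bool_unique[OF fN])
      show "u \<in> ?N" "c {u, x} = i" using e(1,3) u by simp_all
      show "v = u" if "v \<in> ?N" "c {v, x} = i" for v
        using that(1) by (intro un[OF _ that(2)]) simp
    qed
    then show ?thesis using True by simp
  next
    case False
    then have "\<not> c {u, x} = i" if "u \<in> ?N" for u using that by (auto simp: incident_edges_def)
    then show ?thesis using False by simp
  qed
qed

text \<open>At each vertex all leaving darts carry one of the two colourings and all entering darts
  the other, so equal colour sets mean excess zero. Vertices outside \<open>G\<close> are treated
  separately because balance quantifies over the whole type.\<close>

lemma colorable_imp_balanced:
  assumes G: "simple_graph G" "bipartite G" and "two_simultaneous_edge_colorable G"
  shows "\<exists>f. balanced (edges G) f"
proof -
  obtain l c1 c2 where c: "two_simultaneous_edge_coloring G l c1 c2"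
    using assms(3) by (auto simp: two_simultaneous_edge_colorable_def)
  obtain A B where AB: "A \<union> B = verts G" "A \<inter> B = {}" "\<forall>e\<in>edges G. \<exists>a\<in>A. \<exists>b\<in>B. e = {a, b}"
    using G(2) by (auto simp: bipartite_def)
  define f where "f u v = (if u \<in> A then c1 {u, v} else c2 {u, v})" for u v
  have side: "u \<in> A \<longleftrightarrow> v \<notin> A" if "{u, v} \<in> edges G" for u v
    using bipartite_edgeE[OF AB(3,2) that] AB(2) by auto
  have "antiparallel_distinct (edges G) f"
    unfolding antiparallel_distinct_def
  proof (intro allI impI)
    fix u v assume uv: "{u, v} \<in> edges G"
    then have "c1 {u, v} \<noteq> c2 {u, v}" using c by (auto simp: two_simultaneous_edge_coloring_def)
    then show "f u v \<noteq> f v u" using side[OF uv] by (auto simp: f_def insert_commute)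
  qed
  moreover have "excess (edges G) f x i = 0" for x i
  proof (cases "x \<in> verts G")
    case True
    let ?N = "{u. {u, x} \<in> edges G}"
    have 1: "(\<Sum>u\<in>?N. of_bool (c1 {u, x} = i)) = (\<Sum>u\<in>?N. of_bool (c2 {u, x} = i) :: int)"
      using c proper_coloring_count[OF G(1) _ True] unfolding two_simultaneous_edge_coloring_def
      by (metis True)
    show ?thesis
    proof (cases "x \<in> A")
      case True
      have "excess (edges G) f x i = (\<Sum>u\<in>?N. of_bool (c2 {u, x} = i) - of_bool (c1 {u, x} = i))"
        unfolding excess_def by (rule sum.cong) (use True side in \<open>auto simp: f_def insert_commute\<close>)
      then show ?thesis by (simp only: 1 sum_subtractf diff_self)
    next
      case False
      have "excess (edges G) f x i = (\<Sum>u\<in>?N. of_bool (c1 {u, x} = i) - of_bool (c2 {u, x} = i))"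
        unfolding excess_def by (rule sum.cong) (use False side in \<open>auto simp: f_def insert_commute\<close>)
      then show ?thesis by (simp only: 1 sum_subtractf diff_self)
    qed
  next
    case False
    then have "{u. {u, x} \<in> edges G} = {}" using simple_edgeD[OF G(1)] by auto
    then show ?thesis by (simp add: excess_def)
  qed
  ultimately show ?thesis unfolding balanced_def by blast
qed

text \<open>After refinement to a colouring that is injective on the darts leaving and on those
  entering each vertex, the darts from \<open>A\<close> to \<open>B\<close> give one proper
  colouring and those from \<open>B\<close> to \<open>A\<close> the other.\<close>

lemma balanced_imp_colorable:
  assumes G: "simple_graph G" "bipartite G" and "balanced (edges G) f"
  shows "two_simultaneous_edge_colorable G"
proof -
  have fin: "finite (edges G)" using G(1) by (rule finite_edges)
  obtain g where g: "balanced (edges G) g"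
    "\<And>x u v. {x, u} \<in> edges G \<Longrightarrow> {x, v} \<in> edges G \<Longrightarrow> g x u = g x v \<Longrightarrow> u = v"
    "\<And>x u v. {u, x} \<in> edges G \<Longrightarrow> {v, x} \<in> edges G \<Longrightarrow> g u x = g v x \<Longrightarrow> u = v"
    using balanced_proper[OF fin assms(3)] by metis
  obtain A B where AB: "A \<union> B = verts G" "A \<inter> B = {}" "\<forall>e\<in>edges G. \<exists>a\<in>A. \<exists>b\<in>B. e = {a, b}"
    using G(2) by (auto simp: bipartite_def)
  define fa where "fa e = (THE a. a \<in> e \<inter> A)" for e
  define fb where "fb e = (THE b. b \<in> e \<inter> B)" for e
  have fab: "fa {a, b} = a" "fb {a, b} = b" if "a \<in> A" "b \<in> B" for a b
    unfolding fa_def fb_def using that AB(2) by (auto intro!: the_equality)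
  \<comment> \<open>\<open>Suc\<close> because dart colours may be 0, whereas proper colourings use
    1 to \<open>l\<close>.\<close>
  define c1 where "c1 e = Suc (g (fa e) (fb e))" for e
  define c2 where "c2 e = Suc (g (fb e) (fa e))" for e
  \<comment> \<open>The inserted 0 keeps \<open>Max\<close> defined for a graph without
    edges.\<close>
  define l where "l = Max (insert 0 (c1 ` edges G \<union> c2 ` edges G))"
  have range: "c1 ` edges G \<subseteq> {1..l}" "c2 ` edges G \<subseteq> {1..l}"
    using fin by (auto simp: l_def) (auto simp: c1_def c2_def)
  have cE: "c1 {a, b} = Suc (g a b)" "c2 {a, b} = Suc (g b a)" if "a \<in> A" "b \<in> B" for a b
    using fab[OF that] by (auto simp: c1_def c2_def)
  have E: "\<exists>a\<in>A. \<exists>b\<in>B. e = {a, b}" if "e \<in> edges G" for e using AB(3) that by auto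
  have inj: "a = a' \<and> b = b'" if "{a, b} \<in> edges G" "{a', b'} \<in> edges G" "a = a' \<or> b = b'"
     "g a b = g a' b' \<or> g b a = g b' a'" for a b a' b'
    using that g(2)[of a b b'] g(3)[of a b a'] g(2)[of b a a'] g(3)[of b a b'] by (auto simp: insert_commute)
  have proper: "proper_edge_coloring G l c1 \<and> proper_edge_coloring G l c2"
  proof -
    have "c1 e \<noteq> c1 e' \<and> c2 e \<noteq> c2 e'"
      if e: "e \<in> edges G" "e' \<in> edges G" "e \<noteq> e'" "e \<inter> e' \<noteq> {}" for e e'
    proof -
      obtain a b where ab: "a \<in> A" "b \<in> B" "e = {a, b}" using E[OF e(1)] by auto
      obtain a' b' where ab': "a' \<in> A" "b' \<in> B" "e' = {a', b'}" using E[OF e(2)] by auto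
      have "a = a' \<or> b = b'" using e(4) ab ab' AB(2) by auto
      then show ?thesis using inj[of a b a' b'] ab ab' e cE by auto
    qed
    then show ?thesis using range by (simp add: proper_edge_coloring_def)
  qed
  moreover have "c1 e \<noteq> c2 e" if e: "e \<in> edges G" for e
  proof -
    obtain a b where ab: "a \<in> A" "b \<in> B" "e = {a, b}" using E[OF e] by auto
    then show ?thesis using g(1) e cE by (auto simp: balanced_def antiparallel_distinct_def)
  qed
  moreover have "c1 ` incident_edges G x = c2 ` incident_edges G x" if x: "x \<in> verts G" for x
  proof -
    let ?N = "{u. {u, x} \<in> edges G}"
    have "(\<Sum>u\<in>?N. of_bool (c1 {u, x} = i)) = (\<Sum>u\<in>?N. of_bool (c2 {u, x} = i) :: int)" for i
    proof (cases i)
      case 0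
      then show ?thesis by (simp add: c1_def c2_def)
    next
      case (Suc j)
      have 0: "(\<Sum>u\<in>?N. of_bool (g u x = j)) = (\<Sum>u\<in>?N. of_bool (g x u = j) :: int)"
        using g(1) unfolding balanced_def excess_def sum_subtractf by simp
      show ?thesis
      proof (cases "x \<in> A")
        case True
        then have "u \<in> B" if "u \<in> ?N" for u
          using bipartite_edgeE[OF AB(3,2), of u x] that AB(2) by auto
        then have "c1 {u, x} = Suc (g x u) \<and> c2 {u, x} = Suc (g u x)" if "u \<in> ?N" for u
          using cE[of x u] True that by (auto simp: insert_commute)
        then show ?thesis using 0 Suc by simp
      next
        case False
        then have "u \<in> A \<and> x \<in> B" if "u \<in> ?N" for u
          using bipartite_edgeE[OF AB(3,2), of u x] that AB(2) by auto
        then have "c1 {u, x} = Suc (g u x) \<and> c2 {u, x} = Suc (g x u)" if "u \<in> ?N" for u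
          using cE[of u x] that by auto
        then show ?thesis using 0 Suc by simp
      qed
    qed
    then have "(of_bool (i \<in> c1 ` incident_edges G x) :: int) = of_bool (i \<in> c2 ` incident_edges G x)" for i
      using proper_coloring_count[OF G(1) _ x] proper by metis
    then show ?thesis by (auto simp: of_bool_eq_iff)
  qed
  ultimately have "two_simultaneous_edge_coloring G l c1 c2"
    unfolding two_simultaneous_edge_coloring_def by auto
  then show ?thesis by (auto simp: two_simultaneous_edge_colorable_def)
qed

section \<open>Regular bipartite graphs\<close>

text \<open>The Halmos-Vaughan induction. If every nonempty proper subset has a surplus of
  neighbours, one element is matched arbitrarily and the condition survives the loss of one
  neighbour. Otherwise some tight \<open>X\<close> is matched within its own neighbours, and the
  rest is matched outside them; tightness yields the condition for the rest.\<close>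

lemma hall_marriage:
  assumes "finite A" "\<And>a. a \<in> A \<Longrightarrow> finite (N a)"
    and "\<And>X. X \<subseteq> A \<Longrightarrow> card X \<le> card (\<Union>(N ` X))"
  shows "\<exists>h. inj_on h A \<and> (\<forall>a\<in>A. h a \<in> N a)"
  using assms
proof (induction "card A" arbitrary: A N rule: less_induct)
  case less
  have fin: "finite (\<Union>(N ` X))" if "X \<subseteq> A" for X
    using less.prems(1,2) that by (meson finite_UN finite_subset subsetD)
  show ?case
  proof (cases "A = {}")
    case True
    then show ?thesis by simp
  next
    case False
    then obtain a where a: "a \<in> A" by auto
    show ?thesis
    proof (cases "\<forall>X. X \<noteq> {} \<longrightarrow> X \<subset> A \<longrightarrow> card X < card (\<Union>(N ` X))")
      case True
      have "card {a} \<le> card (\<Union>(N ` {a}))" using a by (intro less.prems) auto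
      then obtain b where b: "b \<in> N a" by (cases "N a = {}") auto
      have "\<exists>h. inj_on h (A - {a}) \<and> (\<forall>x\<in>A - {a}. h x \<in> N x - {b})"
      proof (rule less.hyps)
        show "card (A - {a}) < card A" using a less.prems(1) by (meson card_Diff1_less)
        show "card X \<le> card (\<Union>x\<in>X. N x - {b})" if X: "X \<subseteq> A - {a}" for X
        proof (cases "X = {}")
          case False
          then have lt: "card X < card (\<Union>(N ` X))" using True X a by blast
          have "(\<Union>x\<in>X. N x - {b}) = \<Union>(N ` X) - {b}" by auto
          moreover have "card (\<Union>(N ` X)) - 1 \<le> card (\<Union>(N ` X) - {b})"
            by (simp add: card_Diff_singleton_if)
          ultimately show ?thesis using lt by simp
        qed simp
      qed (use less.prems in auto)
      then obtain h where h: "inj_on h (A - {a})" "\<And>x. x \<in> A - {a} \<Longrightarrow> h x \<in> N x - {b}" by blast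
      have "inj_on (h(a := b)) A" using h by (auto simp: inj_on_def)
      moreover have "\<forall>x\<in>A. (h(a := b)) x \<in> N x" using h b by auto
      ultimately show ?thesis by blast
    next
      case False
      then obtain X where X: "X \<noteq> {}" "X \<subset> A" "card (\<Union>(N ` X)) \<le> card X" by (auto simp: not_less)
      have fX: "finite X" using X(2) less.prems(1) by (meson finite_subset psubset_imp_subset)
      have "\<exists>h. inj_on h X \<and> (\<forall>x\<in>X. h x \<in> N x)"
      proof (rule less.hyps)
        show "card X < card A" using X(2) less.prems(1) by (rule psubset_card_mono[rotated])
        show "card Y \<le> card (\<Union>(N ` Y))" if "Y \<subseteq> X" for Y
          using that X(2) by (intro less.prems(3)) auto
      qed (use X(2) fX less.prems(2) in auto)
      then obtain h1 where h1: "inj_on h1 X" "\<And>x. x \<in> X \<Longrightarrow> h1 x \<in> N x" by blast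
      have "\<exists>h. inj_on h (A - X) \<and> (\<forall>x\<in>A - X. h x \<in> N x - \<Union>(N ` X))"
      proof (rule less.hyps)
        show "card (A - X) < card A" using X less.prems(1) by (intro psubset_card_mono) auto
        show "card Y \<le> card (\<Union>x\<in>Y. N x - \<Union>(N ` X))" if Y: "Y \<subseteq> A - X" for Y
        proof -
          have fY: "finite Y" using Y less.prems(1) by (meson finite_Diff finite_subset)
          have "(\<Union>x\<in>Y. N x - \<Union>(N ` X)) = \<Union>(N ` (X \<union> Y)) - \<Union>(N ` X)" by auto
          then have "card (\<Union>x\<in>Y. N x - \<Union>(N ` X)) = card (\<Union>(N ` (X \<union> Y))) - card (\<Union>(N ` X))"
            using fin[of X] X(2) by (simp add: card_Diff_subset)
          moreover have "card (X \<union> Y) = card X + card Y"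
            using fX fY Y by (intro card_Un_disjoint) auto
          moreover have "card (X \<union> Y) \<le> card (\<Union>(N ` (X \<union> Y)))"
            using X(2) Y by (intro less.prems) auto
          ultimately show ?thesis using X(3) by linarith
        qed
      qed (use less.prems in auto)
      then obtain h2 where h2: "inj_on h2 (A - X)" "\<And>x. x \<in> A - X \<Longrightarrow> h2 x \<in> N x - \<Union>(N ` X)" by blast
      define h where "h x = (if x \<in> X then h1 x else h2 x)" for x
      have "h x \<noteq> h y" if "x \<in> X" "y \<in> A - X" for x y
        using h1(2)[OF that(1)] h2(2)[OF that(2)] that unfolding h_def by (metis DiffD2 UN_I)
      then have "inj_on h (X \<union> (A - X))" 
        using h1(1) h2(1) unfolding inj_on_def h_def by (smt (verit, ccfv_threshold) Diff_iff Un_iff)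
      moreover have "X \<union> (A - X) = A" using X(2) by auto
      ultimately have "inj_on h A" by simp
      moreover have "\<forall>x\<in>A. h x \<in> N x" using h1(2) h2(2) by (auto simp: h_def)
      ultimately show ?thesis by blast
    qed
  qed
qed

text \<open>Koenig's theorem for regular graphs: Hall's theorem yields a perfect matching, which
  gets the last colour \<open>k\<close>, and its removal leaves a regular graph of degree one
  less.\<close>

lemma regular_bipartite_edge_coloring:
  assumes "finite A" "finite B" "R \<subseteq> A \<times> B"
    and "\<And>a. a \<in> A \<Longrightarrow> card (R `` {a}) = k" "\<And>b. b \<in> B \<Longrightarrow> card (R\<inverse> `` {b}) = k"
  shows "\<exists>c. (\<forall>p\<in>R. c p < k) \<and> (\<forall>a. inj_on (\<lambda>b. c (a, b)) (R `` {a})) \<and>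
    (\<forall>b. inj_on (\<lambda>a. c (a, b)) (R\<inverse> `` {b}))"
  using assms
proof (induction k arbitrary: R)
  case 0
  have "finite R" using 0(1-3) by (meson finite_SigmaI finite_subset)
  then have "R `` {a} = {}" if "a \<in> A" for a using 0(4)[OF that] by (simp add: finite_Image)
  then have "R = {}" using 0(3) by auto
  then show ?case by simp
next
  case (Suc k)
  have fR: "finite R" using Suc.prems(1-3) by (meson finite_SigmaI finite_subset)
  have fi: "finite (R `` {a})" "finite (R\<inverse> `` {b})" for a b
    using fR by (auto intro: finite_Image)
  have cA: "card (SIGMA a:X. R `` {a}) = Suc k * card X" if "X \<subseteq> A" for X
    using that Suc.prems(1,4) fi by (subst card_SigmaI) (auto intro: finite_subset simp: subset_iff)
  have cB: "card (SIGMA b:Y. R\<inverse> `` {b}) = Suc k * card Y" if "Y \<subseteq> B" for Y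
    using that Suc.prems(2,5) fi by (subst card_SigmaI) (auto intro: finite_subset simp: subset_iff)
  \<comment> \<open>Double counting: the \<open>Suc k * card X\<close> edges at \<open>X\<close> are
    among the \<open>Suc k * card ?Y\<close> edges at its neighbours.\<close>
  have hall_cond: "card X \<le> card (\<Union>a\<in>X. R `` {a})" if X: "X \<subseteq> A" for X
  proof -
    let ?Y = "\<Union>a\<in>X. R `` {a}"
    have Y: "?Y \<subseteq> B" using Suc.prems(3) by auto
    have "finite (SIGMA b:?Y. R\<inverse> `` {b})" using Y Suc.prems(2) fi by (meson finite_SigmaI finite_subset)
    then have "card (SIGMA a:X. R `` {a}) \<le> card (SIGMA b:?Y. R\<inverse> `` {b})"
      by (intro card_inj_on_le[where f = prod.swap]) auto
    then show ?thesis unfolding cA[OF X] cB[OF Y] by (simp only: Suc_mult_le_cancel1)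
  qed
  then obtain h where h: "inj_on h A" "\<And>a. a \<in> A \<Longrightarrow> (a, h a) \<in> R"
    using hall_marriage[of A "\<lambda>a. R `` {a}"] Suc.prems(1) fi by auto
  have "card (SIGMA a:A. R `` {a}) = card (SIGMA b:B. R\<inverse> `` {b})"
    using Suc.prems(3) by (intro bij_betw_same_card[of prod.swap]) (auto simp: bij_betw_def image_iff)
  then have "card A = card B"
    unfolding cA[OF subset_refl] cB[OF subset_refl] by (simp only: Suc_mult_cancel1)
  moreover have "h ` A \<subseteq> B" using h Suc.prems(3) by auto
  \<comment> \<open>Both classes have equal size, so the matching also covers \<open>B\<close> and
    degrees drop by one on both sides.\<close>
  ultimately have hB: "h ` A = B" using h(1) Suc.prems(2) by (simp add: card_seteq card_image)
  define R' where "R' = R - {(a, h a) | a. a \<in> A}"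
  have "\<exists>c. (\<forall>p\<in>R'. c p < k) \<and> (\<forall>a. inj_on (\<lambda>b. c (a, b)) (R' `` {a})) \<and>
    (\<forall>b. inj_on (\<lambda>a. c (a, b)) (R'\<inverse> `` {b}))"
  proof (rule Suc.IH)
    show "R' \<subseteq> A \<times> B" using Suc.prems(3) by (auto simp: R'_def)
    show "card (R' `` {a}) = k" if "a \<in> A" for a
    proof -
      have "R' `` {a} = R `` {a} - {h a}" using that by (auto simp: R'_def)
      then show ?thesis using that h(2) fi Suc.prems(4) by simp
    qed
    show "card (R'\<inverse> `` {b}) = k" if b: "b \<in> B" for b
    proof -
      obtain a where a: "a \<in> A" "h a = b" using b hB by auto
      have "R'\<inverse> `` {b} = R\<inverse> `` {b} - {a}" using a h(1) by (auto simp: R'_def inj_on_def)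
      then show ?thesis using a b h(2) fi Suc.prems(5) by auto
    qed
  qed (use Suc.prems in auto)
  then obtain c where c: "\<And>p. p \<in> R' \<Longrightarrow> c p < k" "\<And>a. inj_on (\<lambda>b. c (a, b)) (R' `` {a})"
    "\<And>b. inj_on (\<lambda>a. c (a, b)) (R'\<inverse> `` {b})" by auto
  define c' where "c' p = (if p \<in> R' then c p else k)" for p
  have out: "b = h a \<and> a \<in> A" if "(a, b) \<in> R" "(a, b) \<notin> R'" for a b
    using that by (auto simp: R'_def)
  have ne: "c p \<noteq> k" if "p \<in> R'" for p using c(1)[OF that] by simp
  have "inj_on (\<lambda>b. c' (a, b)) (R `` {a})" for a
  proof (rule inj_onI)
    fix b b' assume b: "b \<in> R `` {a}" "b' \<in> R `` {a}" "c' (a, b) = c' (a, b')"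
    then have *: "(a, b) \<in> R' \<longleftrightarrow> (a, b') \<in> R'" using ne unfolding c'_def by metis
    show "b = b'"
    proof (cases "(a, b) \<in> R'")
      case True
      then show ?thesis using * b(3) inj_onD[OF c(2)[of a], of b b'] by (simp add: c'_def)
    next
      case False
      then show ?thesis using * b out[of a b] out[of a b'] by simp
    qed
  qed
  moreover have "inj_on (\<lambda>a. c' (a, b)) (R\<inverse> `` {b})" for b
  proof (rule inj_onI)
    fix a a' assume a: "a \<in> R\<inverse> `` {b}" "a' \<in> R\<inverse> `` {b}" "c' (a, b) = c' (a', b)"
    then have *: "(a, b) \<in> R' \<longleftrightarrow> (a', b) \<in> R'" using ne unfolding c'_def by metis
    show "a = a'"
    proof (cases "(a, b) \<in> R'")
      case True
      then show ?thesis using * a(3) inj_onD[OF c(3)[of b], of a a'] by (simp add: c'_def)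
    next
      case False
      then have "b = h a \<and> a \<in> A" "b = h a' \<and> a' \<in> A" using * a out[of a b] out[of a' b] by simp_all
      then show ?thesis using inj_onD[OF h(1), of a a'] by simp
    qed
  qed
  moreover have "c' p < Suc k" for p using c(1)[of p] by (auto simp: c'_def)
  ultimately show ?case by (intro exI[of _ c'] conjI ballI allI)
qed

lemma degree_eq_card_nbrs:
  assumes "simple_graph G"
  shows "degree G x = card {u. {u, x} \<in> edges G}"
proof -
  have "incident_edges G x = (\<lambda>u. {u, x}) ` {u. {u, x} \<in> edges G}"
  proof (intro equalityI subsetI)
    fix e assume e: "e \<in> incident_edges G x"
    then have "e \<in> edges G" by (simp add: incident_edges_def)
    from simple_edgeE[OF assms this] obtain a b where "e = {a, b}" .
    with e show "e \<in> (\<lambda>u. {u, x}) ` {u. {u, x} \<in> edges G}"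
      by (auto simp: incident_edges_def insert_commute)
  qed (auto simp: incident_edges_def)
  moreover have "inj_on (\<lambda>u. {u, x}) {u. {u, x} \<in> edges G}"
    by (auto simp: inj_on_def doubleton_eq_iff)
  ultimately show ?thesis unfolding degree_def by (simp add: card_image)
qed

lemma bij_betw_Suc_mod:
  assumes "0 < k" shows "bij_betw (\<lambda>j. Suc j mod k) {..<k} {..<k}"
proof -
  have "inj_on (\<lambda>j. Suc j mod k) {..<k}" by (auto simp: inj_on_def mod_Suc split: if_splits)
  moreover have "(\<lambda>j. Suc j mod k) ` {..<k} \<subseteq> {..<k}" using assms by auto
  ultimately show ?thesis by (simp add: bij_betw_def endo_inj_surj)
qed

text \<open>All \<open>k\<close> colours occur at every vertex, so permuting the colours keeps the
  colour sets; \<open>2 \<le> k\<close> makes the cyclic shift free of fixed points.\<close>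

lemma regular_colorable:
  assumes G: "simple_graph G" "bipartite G" and k: "2 \<le> k" "\<And>v. v \<in> verts G \<Longrightarrow> degree G v = k"
  shows "two_simultaneous_edge_colorable G"
proof -
  obtain A B where AB: "A \<union> B = verts G" "A \<inter> B = {}" "\<forall>e\<in>edges G. \<exists>a\<in>A. \<exists>b\<in>B. e = {a, b}"
    using G(2) by (auto simp: bipartite_def)
  have side: "u \<in> A \<longleftrightarrow> v \<in> B" if "{u, v} \<in> edges G" for u v
    using bipartite_edgeE[OF AB(3,2) that] AB(2) by auto
  have V: "u \<in> A \<union> B" if "{u, v} \<in> edges G" for u v
    using simple_edgeD(1)[OF G(1) that] AB(1) by simp
  define R where "R = {(a, b). a \<in> A \<and> b \<in> B \<and> {a, b} \<in> edges G}"
  have RA: "R `` {a} = {u. {u, a} \<in> edges G}" if "a \<in> A" for a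
    using that side[of a] by (auto simp: R_def insert_commute)
  have RB: "R\<inverse> `` {b} = {u. {u, b} \<in> edges G}" if "b \<in> B" for b
    using that side[of _ b] by (auto simp: R_def)
  have fin: "finite A" "finite B" using AB(1) G(1) unfolding simple_graph_def
    by (metis finite_Un)+
  have "\<exists>c. (\<forall>p\<in>R. c p < k) \<and> (\<forall>a. inj_on (\<lambda>b. c (a, b)) (R `` {a})) \<and>
    (\<forall>b. inj_on (\<lambda>a. c (a, b)) (R\<inverse> `` {b}))"
  proof (rule regular_bipartite_edge_coloring[OF fin])
    show "R \<subseteq> A \<times> B" by (auto simp: R_def)
    show "card (R `` {a}) = k" if "a \<in> A" for a
      using k(2)[of a] that AB(1) unfolding RA[OF that] degree_eq_card_nbrs[OF G(1)] by auto
    show "card (R\<inverse> `` {b}) = k" if "b \<in> B" for b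
      using k(2)[of b] that AB(1) unfolding RB[OF that] degree_eq_card_nbrs[OF G(1)] by auto
  qed
  then obtain c where c: "\<And>p. p \<in> R \<Longrightarrow> c p < k" "\<And>a. inj_on (\<lambda>b. c (a, b)) (R `` {a})"
    "\<And>b. inj_on (\<lambda>a. c (a, b)) (R\<inverse> `` {b})" by auto
  define f where "f u v = (if u \<in> A then c (u, v) else Suc (c (v, u)) mod k)" for u v
  have shift: "Suc j mod k \<noteq> j" if "j < k" for j using that k(1) by (auto simp: mod_Suc)
  have "antiparallel_distinct (edges G) f"
    unfolding antiparallel_distinct_def
  proof (intro allI impI)
    fix u v assume uv: "{u, v} \<in> edges G"
    then have vu: "{v, u} \<in> edges G" by (simp add: insert_commute)
    show "f u v \<noteq> f v u"
    proof (cases "u \<in> A")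
      case True
      then have "(u, v) \<in> R" "v \<notin> A" using side[OF uv] uv AB(2) by (auto simp: R_def)
      then show ?thesis using True shift[OF c(1)] by (metis f_def)
    next
      case False
      then have "(v, u) \<in> R" "v \<in> A" using side[OF vu] V[OF uv] vu AB(2) by (auto simp: R_def)
      then show ?thesis using False shift[OF c(1)] by (metis f_def)
    qed
  qed
  moreover have "excess (edges G) f x i = 0" for x i
  proof -
    let ?N = "{u. {u, x} \<in> edges G}"
    have count: "(\<Sum>u\<in>?N. of_bool (Suc (g u) mod k = i)) = (\<Sum>u\<in>?N. of_bool (g u = i) :: int)"
      if g: "inj_on g ?N" "g ` ?N \<subseteq> {..<k}" "card ?N = k" for g :: "'a \<Rightarrow> nat"
    proof -
      have "g ` ?N = {..<k}" using g by (intro card_seteq) (auto simp: card_image)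
      then have bij: "bij_betw g ?N {..<k}" using g(1) by (simp add: bij_betw_def)
      have "(\<Sum>u\<in>?N. of_bool (Suc (g u) mod k = i)) = (\<Sum>j<k. of_bool (Suc j mod k = i) :: int)"
        using sum.reindex_bij_betw[OF bij, of "\<lambda>j. of_bool (Suc j mod k = i)"] .
      also have "\<dots> = (\<Sum>j<k. of_bool (j = i))"
        using k(1) by (intro sum.reindex_bij_betw[OF bij_betw_Suc_mod[of k], of "\<lambda>j. of_bool (j = i)"]) simp
      also have "\<dots> = (\<Sum>u\<in>?N. of_bool (g u = i))"
        using sum.reindex_bij_betw[OF bij, of "\<lambda>j. of_bool (j = i)"] by (rule sym)
      finally show ?thesis .
    qed
    consider "x \<in> A" | "x \<in> B" "x \<notin> A" | "x \<notin> verts G" using AB(1) by auto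
    then show ?thesis
    proof cases
      case 1
      have uA: "u \<notin> A" if "u \<in> ?N" for u using side[of u x] 1 that AB(2) by auto
      have cardN: "card ?N = k"
        using k(2)[of x] 1 AB(1) by (auto simp: degree_eq_card_nbrs[OF G(1)])
      have "(\<Sum>u\<in>?N. of_bool (Suc (c (x, u)) mod k = i)) = (\<Sum>u\<in>?N. of_bool (c (x, u) = i) :: int)"
        using c(2)[of x] c(1) cardN unfolding RA[OF 1, symmetric] by (intro count[unfolded RA[OF 1, symmetric]]) auto
      have "excess (edges G) f x i = (\<Sum>u\<in>?N. of_bool (Suc (c (x, u)) mod k = i) - of_bool (c (x, u) = i))"
        unfolding excess_def by (rule sum.cong) (use 1 uA in \<open>auto simp: f_def\<close>)
      also have "\<dots> = 0"
        unfolding sum_subtractf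
        using \<open>_ = (\<Sum>u\<in>?N. of_bool (c (x, u) = i))\<close> by simp
      finally show ?thesis .
    next
      case 2
      have uA: "u \<in> A" if "u \<in> ?N" for u using side[of u x] 2 that by auto
      have cardN: "card ?N = k"
        using k(2)[of x] 2 AB(1) by (auto simp: degree_eq_card_nbrs[OF G(1)])
      have "(\<Sum>u\<in>?N. of_bool (Suc (c (u, x)) mod k = i)) = (\<Sum>u\<in>?N. of_bool (c (u, x) = i) :: int)"
        using c(3)[of x] c(1) cardN unfolding RB[OF 2(1), symmetric] by (intro count[unfolded RB[OF 2(1), symmetric]]) auto
      have "excess (edges G) f x i = (\<Sum>u\<in>?N. of_bool (c (u, x) = i) - of_bool (Suc (c (u, x)) mod k = i))"
        unfolding excess_def by (rule sum.cong) (use 2 uA in \<open>auto simp: f_def\<close>)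
      also have "\<dots> = 0"
        unfolding sum_subtractf
        using \<open>_ = (\<Sum>u\<in>?N. of_bool (c (u, x) = i))\<close> by simp
      finally show ?thesis .
    next
      case 3
      then have "?N = {}" using simple_edgeD(2)[OF G(1)] by auto
      then show ?thesis by (simp add: excess_def)
    qed
  qed
  ultimately have "balanced (edges G) f" by (simp add: balanced_def)
  then show ?thesis by (rule balanced_imp_colorable[OF G])
qed

section \<open>Edge cuts and isomorphic copies\<close>

definition adj :: "'a ugraph \<Rightarrow> 'a \<Rightarrow> 'a \<Rightarrow> bool" where
  "adj G u v \<longleftrightarrow> {u, v} \<in> edges G"

text \<open>For disjoint \<open>S\<close> and \<open>T\<close>, distinct pairs are distinct edges,
  so this says that at least two edges join them. Witnesses as pairs can be mapped from one graph to
  another without computing cardinalities.\<close>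

definition two_darts :: "'a ugraph \<Rightarrow> 'a set \<Rightarrow> 'a set \<Rightarrow> bool" where
  "two_darts G S T \<longleftrightarrow> (\<exists>a\<in>S. \<exists>b\<in>T. \<exists>a'\<in>S. \<exists>b'\<in>T.
     adj G a b \<and> adj G a' b' \<and> (a, b) \<noteq> (a', b'))"

lemma adj_sym: "adj G u v \<longleftrightarrow> adj G v u"
  by (simp add: adj_def insert_commute)

lemma adjD:
  assumes "simple_graph G" "adj G u v"
  shows "u \<in> verts G" "v \<in> verts G" "u \<noteq> v"
  using simple_edgeD[OF assms(1)] assms(2) by (auto simp: adj_def)

lemma two_dartsI:
  assumes "a \<in> S" "b \<in> T" "a' \<in> S" "b' \<in> T" "adj G a b" "adj G a' b'" "(a, b) \<noteq> (a', b')"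
  shows "two_darts G S T"
  unfolding two_darts_def using assms by blast

lemma two_dartsE:
  assumes "two_darts G S T"
  obtains a b a' b' where "a \<in> S" "b \<in> T" "a' \<in> S" "b' \<in> T" "adj G a b" "adj G a' b'"
    "(a, b) \<noteq> (a', b')"
  using assms unfolding two_darts_def by blast

lemma two_darts_swap: "two_darts G S T \<Longrightarrow> two_darts G T S"
  unfolding two_darts_def by (metis adj_sym prod.inject)

lemma two_darts_neq:
  assumes "two_darts G S T"
  obtains c d where "c \<in> S" "d \<in> T" "adj G c d" "(c, d) \<noteq> (a, b)"
  using assms by (elim two_dartsE) metis

lemma cut_edgesE:
  assumes "e \<in> cut_edges G S"
  obtains a b where "a \<in> S" "b \<in> verts G - S" "adj G a b" "e = {a, b}"
  using assms by (auto simp: cut_edges_def adj_def)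

lemma cut_edgesI:
  assumes "a \<in> S" "b \<in> verts G - S" "adj G a b"
  shows "{a, b} \<in> cut_edges G S"
  using assms by (auto simp: cut_edges_def adj_def)

lemma finite_cut_edges: "simple_graph G \<Longrightarrow> finite (cut_edges G S)"
  unfolding cut_edges_def by (simp add: finite_edges)

lemma two_darts_iff_card_cut:
  assumes "simple_graph G"
  shows "two_darts G S (verts G - S) \<longleftrightarrow> 2 \<le> card (cut_edges G S)"
proof
  assume "two_darts G S (verts G - S)"
  then obtain a b a' b' where *: "a \<in> S" "b \<in> verts G - S" "a' \<in> S" "b' \<in> verts G - S"
    "adj G a b" "adj G a' b'" "(a, b) \<noteq> (a', b')" by (rule two_dartsE)
  then have "{a, b} \<noteq> {a', b'}" by (auto simp: doubleton_eq_iff)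
  then have "2 = card {{a, b}, {a', b'}}" by simp
  also have "\<dots> \<le> card (cut_edges G S)"
    using * cut_edgesI[of _ S _ G] by (intro card_mono finite_cut_edges[OF assms]) auto
  finally show "2 \<le> card (cut_edges G S)" .
next
  assume "2 \<le> card (cut_edges G S)"
  then have "\<not> card (cut_edges G S) \<le> Suc 0" by simp
  then obtain e e' where e: "e \<in> cut_edges G S" "e' \<in> cut_edges G S" "e \<noteq> e'"
    unfolding card_le_Suc0_iff_eq[OF finite_cut_edges[OF assms]] by auto
  obtain a b where ab: "a \<in> S" "b \<in> verts G - S" "adj G a b" "e = {a, b}"
    using e(1) by (rule cut_edgesE)
  obtain a' b' where ab': "a' \<in> S" "b' \<in> verts G - S" "adj G a' b'" "e' = {a', b'}"
    using e(2) by (rule cut_edgesE)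
  show "two_darts G S (verts G - S)"
    using ab ab' e(3) by (intro two_dartsI[of a S b _ a' b']) auto
qed

lemma bridgeless_iff:
  assumes "simple_graph G"
  shows "bridgeless G \<longleftrightarrow> 2 \<le> card (verts G) \<and>
    (\<forall>S. S \<noteq> {} \<longrightarrow> S \<subset> verts G \<longrightarrow> two_darts G S (verts G - S))"
proof (cases "card (verts G) \<le> 1")
  case True
  then show ?thesis by (simp add: bridgeless_def edge_connectivity_def)
next
  case False
  let ?C = "{card F | F. edge_cut G F}"
  have "?C \<subseteq> card ` Pow (edges G)" by (auto simp: edge_cut_def cut_edges_def)
  then have fin: "finite ?C" using finite_edges[OF assms] by (meson finite_Pow_iff finite_imageI finite_subset)
  obtain v where v: "v \<in> verts G" using False by fastforce
  moreover have "verts G \<noteq> {v}" using False by auto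
  ultimately have "edge_cut G (cut_edges G {v})" unfolding edge_cut_def by blast
  \<comment> \<open>A cut around a single vertex exists, so the minimum is taken over a nonempty
    set.\<close>
  then have ne: "?C \<noteq> {}" by blast
  have "bridgeless G \<longleftrightarrow> (\<forall>F. edge_cut G F \<longrightarrow> 2 \<le> card F)"
    using False Min_ge_iff[OF fin ne, of 2] by (auto simp: bridgeless_def edge_connectivity_def)
  also have "\<dots> \<longleftrightarrow> (\<forall>S. S \<noteq> {} \<longrightarrow> S \<subset> verts G \<longrightarrow> two_darts G S (verts G - S))"
    unfolding two_darts_iff_card_cut[OF assms] edge_cut_def by auto
  finally show ?thesis using False by auto
qed

lemma bridgelessD:
  assumes "simple_graph G" "bridgeless G" "S \<noteq> {}" "S \<subset> verts G"
  shows "two_darts G S (verts G - S)"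
  using assms bridgeless_iff[OF assms(1)] by blast

text \<open>A set and its complement have the same cut, so it suffices to test sets that avoid a
  root \<open>r\<close>. The root is chosen as the new or exceptional vertex, so that the tested
  sets are sets of old vertices.\<close>

lemma bridgelessI:
  assumes "simple_graph G" "r \<in> verts G" "verts G \<noteq> {r}"
    and "\<And>S. S \<noteq> {} \<Longrightarrow> S \<subseteq> verts G - {r} \<Longrightarrow> two_darts G S (verts G - S)"
  shows "bridgeless G"
  unfolding bridgeless_iff[OF assms(1)]
proof (intro conjI allI impI)
  have "\<not> card (verts G) \<le> Suc 0"
    using assms(1-3) by (subst card_le_Suc0_iff_eq) (auto simp: simple_graph_def)
  then show "2 \<le> card (verts G)" by simp
  fix S assume S: "S \<noteq> {}" "S \<subset> verts G"
  show "two_darts G S (verts G - S)"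
  proof (cases "r \<in> S")
    case True
    then have "two_darts G (verts G - S) (verts G - (verts G - S))"
      using S by (intro assms(4)) auto
    moreover have "verts G - (verts G - S) = S" using S by auto
    ultimately show ?thesis using two_darts_swap by metis
  next
    case False
    then show ?thesis using S by (intro assms(4)) auto
  qed
qed

lemma connectedI:
  assumes "verts H \<noteq> {}"
    and cut: "\<And>S. S \<noteq> {} \<Longrightarrow> S \<subset> verts H \<Longrightarrow> \<exists>a\<in>S. \<exists>b\<in>verts H - S. adj H a b"
  shows "connected H"
  unfolding connected_def
proof (intro conjI ballI)
  fix u w assume uw: "u \<in> verts H" "w \<in> verts H"
  define S where "S = {x \<in> verts H. reachable H u x}"
  show "reachable H u w"
  proof (rule ccontr)
    assume "\<not> reachable H u w"
    then have "S \<noteq> {}" "S \<subset> verts H" using uw by (auto simp: S_def reachable_def)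
    then obtain a b where ab: "a \<in> S" "b \<in> verts H - S" "adj H a b" using cut by blast
    then have "reachable H u b" unfolding S_def reachable_def adj_def
      by (auto intro: rtranclp.rtrancl_into_rtrancl)
    then show False using ab by (auto simp: S_def)
  qed
qed (rule assms(1))

text \<open>Extremality compares \<open>G\<close> with graphs on \<open>nat\<close> only. Copies
  along an injection extend the comparison to every vertex type, and also move \<open>G\<close>
  itself to \<open>nat\<close> when a fresh vertex is required.\<close>

definition map_graph :: "('a \<Rightarrow> 'b) \<Rightarrow> 'a ugraph \<Rightarrow> 'b ugraph" where
  "map_graph h G = \<lparr>verts = h ` verts G, edges = (`) h ` edges G\<rparr>"

context
  fixes h :: "'a \<Rightarrow> 'b" and G :: "'a ugraph"
  assumes G: "simple_graph G" and inj: "inj_on h (verts G)"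
begin

lemma edges_sub: "e \<in> edges G \<Longrightarrow> e \<subseteq> verts G"
  using G by (auto simp: simple_graph_def)

lemma inj_on_edges: "inj_on ((`) h) (edges G)"
  using inj_on_image_eq_iff[OF inj edges_sub edges_sub] by (auto intro: inj_onI)

lemma simple_map_graph: "simple_graph (map_graph h G)"
  using G inj edges_sub unfolding simple_graph_def map_graph_def
  by (auto simp: card_image inj_on_subset)

lemma card_map_graph:
  "card (verts (map_graph h G)) = card (verts G)" "card (edges (map_graph h G)) = card (edges G)"
  using inj inj_on_edges by (simp_all add: map_graph_def card_image)

lemma bipartite_map_graph:
  assumes "bipartite G" shows "bipartite (map_graph h G)"
proof -
  obtain A B where AB: "A \<union> B = verts G" "A \<inter> B = {}" "\<forall>e\<in>edges G. \<exists>a\<in>A. \<exists>b\<in>B. e = {a, b}"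
    using assms by (auto simp: bipartite_def)
  have "h ` A \<inter> h ` B = h ` (A \<inter> B)"
    using AB(1) inj by (intro inj_on_image_Int[symmetric, of h "verts G"]) auto
  moreover have "\<exists>a\<in>h ` A. \<exists>b\<in>h ` B. h ` e = {a, b}" if "e \<in> edges G" for e
    using AB(3) that by fastforce
  ultimately show ?thesis unfolding bipartite_def map_graph_def using AB(1,2)
    by (intro exI[of _ "h ` A"] exI[of _ "h ` B"]) auto
qed

lemma bridgeless_map_graph:
  assumes "bridgeless G" shows "bridgeless (map_graph h G)"
  unfolding bridgeless_iff[OF simple_map_graph]
proof (intro conjI allI impI)
  show "2 \<le> card (verts (map_graph h G))"
    using assms unfolding card_map_graph bridgeless_iff[OF G] by simp
  fix S' assume S': "S' \<noteq> {}" "S' \<subset> verts (map_graph h G)"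
  define S where "S = {x \<in> verts G. h x \<in> S'}"
  have "S \<noteq> {}" "S \<subset> verts G" using S' by (auto simp: S_def map_graph_def)
  then have "two_darts G S (verts G - S)" by (rule bridgelessD[OF G assms])
  then obtain a b a' b' where *: "a \<in> S" "b \<in> verts G - S" "a' \<in> S" "b' \<in> verts G - S"
    "adj G a b" "adj G a' b'" "(a, b) \<noteq> (a', b')" by (rule two_dartsE)
  have ad: "adj (map_graph h G) (h x) (h y)" if "adj G x y" for x y
    using that unfolding adj_def map_graph_def by (auto intro: rev_image_eqI)
  show "two_darts (map_graph h G) S' (verts (map_graph h G) - S')"
    using * ad inj
    by (intro two_dartsI[of "h a" S' "h b" _ "h a'" "h b'"])
      (auto simp: S_def map_graph_def dest: inj_onD)
qed

lemma incident_map_graph: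
  assumes "x \<in> verts G"
  shows "incident_edges (map_graph h G) (h x) = (`) h ` incident_edges G x"
proof -
  have "h x \<in> h ` e \<longleftrightarrow> x \<in> e" if "e \<in> edges G" for e
    using inj assms edges_sub[OF that] by (rule inj_on_image_mem_iff)
  then show ?thesis by (auto simp: incident_edges_def map_graph_def)
qed

lemma degree_map_graph:
  assumes "x \<in> verts G" shows "degree (map_graph h G) (h x) = degree G x"
proof -
  have "inj_on ((`) h) (incident_edges G x)"
    using inj_on_edges by (rule inj_on_subset) (auto simp: incident_edges_def)
  then show ?thesis by (simp add: degree_def incident_map_graph[OF assms] card_image)
qed

lemma colorable_map_graph:
  assumes "two_simultaneous_edge_colorable (map_graph h G)"
  shows "two_simultaneous_edge_colorable G"
proof -
  obtain l c1 c2 where c: "two_simultaneous_edge_coloring (map_graph h G) l c1 c2"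
    using assms by (auto simp: two_simultaneous_edge_colorable_def)
  have proper: "proper_edge_coloring G l (\<lambda>e. c (h ` e))"
    if "proper_edge_coloring (map_graph h G) l c" for c
    unfolding proper_edge_coloring_def
  proof (intro conjI ballI impI)
    show "(\<lambda>e. c (h ` e)) ` edges G \<subseteq> {1..l}"
      using that by (auto simp: proper_edge_coloring_def map_graph_def)
    fix e f assume ef: "e \<in> edges G" "f \<in> edges G" "e \<noteq> f \<and> e \<inter> f \<noteq> {}"
    then have "h ` e \<noteq> h ` f" using inj_onD[OF inj_on_edges, of e f] by auto
    moreover have "h ` e \<inter> h ` f \<noteq> {}" using ef by auto
    ultimately show "c (h ` e) \<noteq> c (h ` f)"
      using that ef by (auto simp: proper_edge_coloring_def map_graph_def)
  qed
  have "two_simultaneous_edge_coloring G l (\<lambda>e. c1 (h ` e)) (\<lambda>e. c2 (h ` e))"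
    unfolding two_simultaneous_edge_coloring_def
  proof (intro conjI ballI)
    fix v assume v: "v \<in> verts G"
    then have "h v \<in> verts (map_graph h G)" by (simp add: map_graph_def)
    then have "c1 ` incident_edges (map_graph h G) (h v) = c2 ` incident_edges (map_graph h G) (h v)"
      using c by (simp add: two_simultaneous_edge_coloring_def)
    then show "(\<lambda>e. c1 (h ` e)) ` incident_edges G v = (\<lambda>e. c2 (h ` e)) ` incident_edges G v"
      unfolding incident_map_graph[OF v] by (simp add: image_image)
  next
    fix e assume "e \<in> edges G"
    then show "c1 (h ` e) \<noteq> c2 (h ` e)"
      using c by (simp add: two_simultaneous_edge_coloring_def map_graph_def)
  qed (use c proper in \<open>auto simp: two_simultaneous_edge_coloring_def\<close>)
  then show ?thesis by (auto simp: two_simultaneous_edge_colorable_def)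
qed

lemma noncolorable_map_graph:
  "bridgeless_bipartite_noncolorable G \<Longrightarrow> bridgeless_bipartite_noncolorable (map_graph h G)"
  unfolding bridgeless_bipartite_noncolorable_def
  using simple_map_graph bridgeless_map_graph bipartite_map_graph colorable_map_graph by auto

end

section \<open>Extremality against graphs over any vertex type\<close>

lemma inj_on_nat_ex:
  assumes "finite A" obtains h :: "'a \<Rightarrow> nat" where "inj_on h A"
  using assms finite_imp_inj_to_nat_seg by metis

lemma extremal_min_edges:
  fixes H :: "'b ugraph"
  assumes "extremal_noncolorable G" "bridgeless_bipartite_noncolorable H"
  shows "card (edges G) \<le> card (edges H)"
proof -
  have H: "simple_graph H" using assms(2) by (simp add: bridgeless_bipartite_noncolorable_def)
  then have "finite (verts H)" by (simp add: simple_graph_def)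
  then obtain h :: "'b \<Rightarrow> nat" where h: "inj_on h (verts H)" by (rule inj_on_nat_ex)
  show ?thesis
    using noncolorable_map_graph[OF H h assms(2)] card_map_graph(2)[OF H h] assms(1)
    unfolding extremal_noncolorable_def by metis
qed

lemma extremal_max_verts:
  fixes H :: "'b ugraph"
  assumes "extremal_noncolorable G" "bridgeless_bipartite_noncolorable H"
    "card (edges H) = card (edges G)"
  shows "card (verts H) \<le> card (verts G)"
proof -
  have H: "simple_graph H" using assms(2) by (simp add: bridgeless_bipartite_noncolorable_def)
  then have "finite (verts H)" by (simp add: simple_graph_def)
  then obtain h :: "'b \<Rightarrow> nat" where h: "inj_on h (verts H)" by (rule inj_on_nat_ex)
  show ?thesis
    using noncolorable_map_graph[OF H h assms(2)] card_map_graph[OF H h] assms(1,3)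
    unfolding extremal_noncolorable_def by metis
qed

lemma extremal_facts:
  assumes "extremal_noncolorable G"
  shows "simple_graph G" "bridgeless G" "bipartite G" "\<not> two_simultaneous_edge_colorable G"
  using assms by (auto simp: extremal_noncolorable_def bridgeless_bipartite_noncolorable_def)

lemma extremal_not_balanced:
  assumes "extremal_noncolorable G" shows "\<not> balanced (edges G) f"
  using extremal_facts[OF assms] balanced_imp_colorable by blast

text \<open>The working form of minimality: each reduction builds such an \<open>H\<close>, takes
  its balanced colouring and modifies it into one of \<open>G\<close>, against
  \<open>extremal_not_balanced\<close>.\<close>

lemma extremal_smaller_balanced:
  fixes H :: "'b ugraph"
  assumes "extremal_noncolorable G" "simple_graph H" "bridgeless H" "bipartite H"
    "card (edges H) < card (edges G)"
  obtains f where "balanced (edges H) f"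
proof -
  have "\<not> bridgeless_bipartite_noncolorable H"
    using extremal_min_edges[OF assms(1), of H] assms(5) by auto
  then have "two_simultaneous_edge_colorable H"
    using assms by (simp add: bridgeless_bipartite_noncolorable_def)
  then show thesis using that colorable_imp_balanced[OF assms(2,4)] by auto
qed

section \<open>Cut vertices and splitting\<close>

lemma bipartite_side:
  assumes "bipartite G"
  shows "\<exists>A. \<forall>u v. adj G u v \<longrightarrow> (u \<in> A \<longleftrightarrow> v \<notin> A)"
proof -
  obtain A B where AB: "A \<union> B = verts G" "A \<inter> B = {}" "\<forall>e\<in>edges G. \<exists>a\<in>A. \<exists>b\<in>B. e = {a, b}"
    using assms by (auto simp: bipartite_def)
  have "u \<in> A \<longleftrightarrow> v \<notin> A" if "adj G u v" for u v
    using bipartite_edgeE[OF AB(3,2), of u v] that AB(2) by (auto simp: adj_def)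
  then show ?thesis by auto
qed

lemma bipartite_sideI:
  assumes "simple_graph G" "\<And>u v. adj G u v \<Longrightarrow> u \<in> A \<longleftrightarrow> v \<notin> A"
  shows "bipartite G"
  unfolding bipartite_def
proof (rule exI[of _ "verts G \<inter> A"], rule exI[of _ "verts G - A"], intro conjI ballI)
  fix e assume e: "e \<in> edges G"
  obtain u v where uv: "e = {u, v}" "u \<in> verts G" "v \<in> verts G"
    using simple_edgeE[OF assms(1) e] by metis
  then have "u \<in> A \<longleftrightarrow> v \<notin> A" using e by (intro assms(2)) (simp add: adj_def)
  then show "\<exists>a\<in>verts G \<inter> A. \<exists>b\<in>verts G - A. e = {a, b}"
    using uv by (cases "u \<in> A") (auto simp: insert_commute)
qed auto

definition induced :: "'a ugraph \<Rightarrow> 'a set \<Rightarrow> 'a ugraph" where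
  "induced G W = \<lparr>verts = W, edges = {e \<in> edges G. e \<subseteq> W}\<rparr>"

lemma verts_induced [simp]: "verts (induced G W) = W"
  by (simp add: induced_def)

lemma edges_induced: "edges (induced G W) = {e \<in> edges G. e \<subseteq> W}"
  by (simp add: induced_def)

lemma adj_induced: "adj (induced G W) u v \<longleftrightarrow> adj G u v \<and> u \<in> W \<and> v \<in> W"
  by (auto simp: adj_def induced_def)

lemma simple_induced:
  assumes "simple_graph G" "W \<subseteq> verts G" shows "simple_graph (induced G W)"
  using assms by (auto simp: simple_graph_def induced_def intro: finite_subset)

lemma bipartite_induced:
  assumes "simple_graph G" "bipartite G" "W \<subseteq> verts G" shows "bipartite (induced G W)"
  using bipartite_side[OF assms(2)] bipartite_sideI[OF simple_induced[OF assms(1,3)]]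
  unfolding adj_induced by metis

definition glue :: "'a set set \<Rightarrow> ('a \<Rightarrow> 'a \<Rightarrow> nat) \<Rightarrow> ('a \<Rightarrow> 'a \<Rightarrow> nat) \<Rightarrow> 'a \<Rightarrow> 'a \<Rightarrow> nat" where
  "glue E f g u v = (if {u, v} \<in> E then f u v else g u v)"

lemma excess_glue:
  assumes "finite E1" "finite E2" "E1 \<inter> E2 = {}"
  shows "excess (E1 \<union> E2) (glue E1 f g) x i = excess E1 f x i + excess E2 g x i"
proof -
  have "excess E1 (glue E1 f g) x i = excess E1 f x i"
    by (rule excess_cong) (simp add: glue_def)
  moreover have "excess E2 (glue E1 f g) x i = excess E2 g x i"
    using assms(3) by (intro excess_cong) (auto simp: glue_def)
  ultimately show ?thesis using excess_Un[OF assms] by simp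
qed

lemma antiparallel_distinct_glue:
  assumes "antiparallel_distinct E1 f" "antiparallel_distinct E2 g"
  shows "antiparallel_distinct (E1 \<union> E2) (glue E1 f g)"
  using assms by (auto simp: antiparallel_distinct_def glue_def insert_commute)

locale extremal =
  fixes G :: "'a ugraph"
  assumes extremal: "extremal_noncolorable G"
begin

lemmas simple = extremal_facts(1)[OF extremal]
lemmas bridgeless = extremal_facts(2)[OF extremal]
lemmas bipartite = extremal_facts(3)[OF extremal]
lemmas not_balanced = extremal_not_balanced[OF extremal]
lemmas smaller_balanced = extremal_smaller_balanced[OF extremal]

lemma finite_E: "finite (edges G)" and finite_V: "finite (verts G)"
  using simple finite_edges by (auto simp: simple_graph_def)

lemma other_nbr:
  assumes "x \<in> verts G" obtains y where "adj G x y" "y \<noteq> z"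
proof -
  have "\<not> card (verts G) \<le> 1" using bridgeless bridgeless_iff[OF simple] by simp
  then have "verts G \<noteq> {x}" by auto
  then have "two_darts G {x} (verts G - {x})"
    using assms by (intro bridgelessD[OF simple bridgeless]) auto
  then obtain y where "adj G x y" "(x, y) \<noteq> (x, z)" by (rule two_darts_neq) auto
  then show thesis using that by auto
qed

text \<open>With root \<open>v\<close> only sets inside \<open>S\<close> are tested. Edges of
  \<open>G\<close> leaving such a set end in \<open>S\<close> or at \<open>v\<close>, so the two
  darts found in \<open>G\<close> remain in the block.\<close>

lemma block_bridgeless:
  assumes "v \<in> verts G" "S \<noteq> {}" "S \<subset> verts G - {v}"
    and no: "\<And>a b. a \<in> S \<Longrightarrow> b \<in> verts G - {v} - S \<Longrightarrow> \<not> adj G a b"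
  shows "bridgeless (induced G (insert v S))"
proof (rule bridgelessI[of _ v])
  show "simple_graph (induced G (insert v S))" using assms by (intro simple_induced[OF simple]) auto
  show "verts (induced G (insert v S)) \<noteq> {v}" using assms by auto
  fix Q assume Q: "Q \<noteq> {}" "Q \<subseteq> verts (induced G (insert v S)) - {v}"
  then have "two_darts G Q (verts G - Q)"
    using assms by (intro bridgelessD[OF simple bridgeless]) auto
  then obtain a b a' b' where *: "a \<in> Q" "b \<in> verts G - Q" "a' \<in> Q" "b' \<in> verts G - Q"
    "adj G a b" "adj G a' b'" "(a, b) \<noteq> (a', b')" by (rule two_dartsE)
  have Q': "Q \<subseteq> S" using Q by auto
  have b: "b \<in> insert v S" if "a \<in> Q" "b \<in> verts G - Q" "adj G a b" for a b
    using no[of a b] that Q' by auto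
  show "two_darts (induced G (insert v S)) Q (verts (induced G (insert v S)) - Q)"
    using * Q' b[of a b] b[of a' b']
    by (intro two_dartsI[of a Q b _ a' b']) (auto simp: adj_induced)
qed simp

text \<open>Otherwise the edges of \<open>G\<close> split into two smaller bridgeless blocks sharing
  only \<open>v\<close>, whose balanced colourings add up to one of \<open>G\<close>. From here on
  this is the standard source of edges: a nonempty proper set of vertices of \<open>G - v\<close> is
  always left by an edge that avoids \<open>v\<close>.\<close>

lemma no_cutvertex:
  assumes v: "v \<in> verts G" and S: "S \<noteq> {}" "S \<subset> verts G - {v}"
  shows "\<exists>a\<in>S. \<exists>b\<in>verts G - {v} - S. adj G a b"
proof (rule ccontr)
  assume "\<not> ?thesis"
  then have no: "\<not> adj G a b" if "a \<in> S" "b \<in> verts G - {v} - S" for a b using that by blast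
  define T where "T = verts G - {v} - S"
  have T: "T \<noteq> {}" "T \<subset> verts G - {v}" "verts G - {v} - T = S" using S by (auto simp: T_def)
  let ?H1 = "induced G (insert v S)" and ?H2 = "induced G (insert v T)"
  have b1: "bridgeless ?H1" using no by (intro block_bridgeless v S) auto
  have b2: "bridgeless ?H2" using no adj_sym[of G] by (intro block_bridgeless v T) (auto simp: T_def)
  have sub: "insert v S \<subseteq> verts G" "insert v T \<subseteq> verts G" using v S T by auto
  \<comment> \<open>Every vertex has a neighbour, so omitting a vertex loses an edge.\<close>
  have less: "card (edges (induced G W)) < card (edges G)" if "x \<in> verts G" "x \<notin> W" for x W
  proof -
    obtain y where "adj G x y" using other_nbr[OF \<open>x \<in> verts G\<close>] .
    then have "{x, y} \<in> edges G" "{x, y} \<notin> edges (induced G W)"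
      using that by (auto simp: adj_def edges_induced)
    then have "edges (induced G W) \<noteq> edges G" "edges (induced G W) \<subseteq> edges G"
      by (metis, simp add: edges_induced)
    then have "edges (induced G W) \<subset> edges G" by (rule psubsetI[rotated])
    then show ?thesis using finite_E by (rule psubset_card_mono[rotated])
  qed
  obtain s t where st: "s \<in> S" "t \<in> T" using S(1) T(1) by auto
  have "t \<in> verts G" "t \<notin> insert v S" using st by (auto simp: T_def)
  then obtain f1 where f1: "balanced (edges ?H1) f1"
    using smaller_balanced[OF simple_induced[OF simple sub(1)] b1 bipartite_induced[OF simple bipartite sub(1)]] less
    by metis
  have "s \<in> verts G" "s \<notin> insert v T" using st S by (auto simp: T_def)
  then obtain f2 where f2: "balanced (edges ?H2) f2"
    using smaller_balanced[OF simple_induced[OF simple sub(2)] b2 bipartite_induced[OF simple bipartite sub(2)]] less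
    by metis
  have fin: "finite (edges ?H1)" "finite (edges ?H2)" using finite_E by (auto simp: edges_induced)
  have disj: "edges ?H1 \<inter> edges ?H2 = {}"
  proof -
    have False if e: "e \<in> edges ?H1" "e \<in> edges ?H2" for e
    proof -
      have "e \<in> edges G" "e \<subseteq> {v}" using e by (auto simp: edges_induced T_def)
      then show False using simple by (auto simp: simple_graph_def dest!: subset_singletonD)
    qed
    then show ?thesis by auto
  qed
  have "edges G = edges ?H1 \<union> edges ?H2"
  proof (intro equalityI subsetI)
    fix e assume e: "e \<in> edges G"
    obtain a b where ab: "e = {a, b}" "a \<in> verts G" "b \<in> verts G" using simple_edgeE[OF simple e] by metis
    have "adj G a b" "adj G b a" using e ab by (auto simp: adj_def insert_commute)
    then have "a \<in> S \<Longrightarrow> b \<in> insert v S" "b \<in> S \<Longrightarrow> a \<in> insert v S"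
      using no[of a b] no[of b a] ab by auto
    then show "e \<in> edges ?H1 \<union> edges ?H2" using e ab by (auto simp: edges_induced T_def)
  qed (auto simp: edges_induced)
  then have "balanced (edges G) (glue (edges ?H1) f1 f2)"
    using f1 f2 antiparallel_distinct_glue excess_glue[OF fin disj] by (auto simp: balanced_def)
  then show False using not_balanced by blast
qed

text \<open>Splitting keeps \<open>\<bar>E\<bar>\<close> and increases \<open>\<bar>V\<bar>\<close>, so by maximality a
  bridgeless split graph would be colourable, and identifying the two copies of \<open>v\<close> again would
  colour \<open>G\<close>.\<close>

definition split_graph :: "'a \<Rightarrow> 'a \<Rightarrow> 'a \<Rightarrow> 'a \<Rightarrow> 'a ugraph" where
  "split_graph v z n m = \<lparr>verts = insert z (verts G),
     edges = insert {z, n} (insert {z, m} (edges G - {{v, n}, {v, m}}))\<rparr>"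

lemma adj_split_graph: "adj (split_graph v z n m) x y \<longleftrightarrow>
    (adj G x y \<and> {x, y} \<noteq> {v, n} \<and> {x, y} \<noteq> {v, m}) \<or> {x, y} = {z, n} \<or> {x, y} = {z, m}"
  by (auto simp: adj_def split_graph_def)

lemma split_graph_not_bridgeless:
  assumes z: "z \<notin> verts G" and nm: "adj G v n" "adj G v m" "n \<noteq> m"
  shows "\<not> bridgeless (split_graph v z n m)"
proof
  let ?H = "split_graph v z n m"
  assume br: "bridgeless ?H"
  have V: "v \<in> verts G" "n \<in> verts G" "m \<in> verts G" "v \<noteq> n" "v \<noteq> m"
    using adjD[OF simple nm(1)] adjD[OF simple nm(2)] by auto
  have zn: "z \<noteq> n" "z \<noteq> m" "z \<noteq> v" using z V by auto
  define E0 where "E0 = edges G - {{v, n}, {v, m}}"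
  have E0: "finite E0" "{v, n} \<notin> E0" "{v, m} \<notin> E0" using finite_E by (auto simp: E0_def)
  have noz: "{a, b} \<notin> E0" if "a = z \<or> b = z" for a b
    using simple_edgeD[OF simple, of a b] z that by (auto simp: E0_def)
  have EH: "edges ?H = insert {z, n} (insert {z, m} E0)" by (simp add: split_graph_def E0_def)
  have EG: "edges G = insert {v, n} (insert {v, m} E0)" using nm by (auto simp: E0_def adj_def)
  have ne: "{v, n} \<noteq> {v, m}" "{z, n} \<noteq> {z, m}" using nm(3) by (auto simp: doubleton_eq_iff)
  have simpH: "simple_graph ?H"
    using simple V zn unfolding simple_graph_def split_graph_def by auto
  have cardE: "card (edges ?H) = card (edges G)"
    unfolding EH EG using E0 ne noz by simp
  have cardV: "card (verts ?H) = Suc (card (verts G))"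
    using z finite_V by (simp add: split_graph_def)
  obtain A where A: "\<And>u v. adj G u v \<Longrightarrow> u \<in> A \<longleftrightarrow> v \<notin> A" using bipartite_side[OF bipartite] by metis
  \<comment> \<open>The new vertex takes the class of \<open>v\<close>. It may have to be removed
    from \<open>A\<close>, which is unconstrained outside \<open>G\<close>.\<close>
  define A' where "A' = (if v \<in> A then insert z A else A - {z})"
  have "bipartite ?H"
  proof (rule bipartite_sideI[OF simpH])
    fix a b assume "adj ?H a b"
    then consider "adj G a b" | "{a, b} = {z, n}" | "{a, b} = {z, m}" unfolding adj_split_graph by auto
    then show "a \<in> A' \<longleftrightarrow> b \<notin> A'"
    proof cases
      case 1
      then have "a \<noteq> z" "b \<noteq> z" using adjD[OF simple 1] z by auto
      then show ?thesis using A[OF 1] by (auto simp: A'_def)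
    next
      case 2
      then show ?thesis using A[OF nm(1)] zn by (auto simp: A'_def doubleton_eq_iff)
    next
      case 3
      then show ?thesis using A[OF nm(2)] zn by (auto simp: A'_def doubleton_eq_iff)
    qed
  qed
  moreover have "\<not> bridgeless_bipartite_noncolorable ?H"
    using extremal_max_verts[OF extremal _ cardE] cardV by auto
  ultimately have "two_simultaneous_edge_colorable ?H"
    using simpH br by (simp add: bridgeless_bipartite_noncolorable_def)
  then obtain f where f: "balanced (edges ?H) f"
    using colorable_imp_balanced[OF simpH \<open>bipartite ?H\<close>] by auto
  define \<sigma> where "\<sigma> x = (if x = v then z else x)" for x
  define g where "g a b = (if {a, b} \<in> E0 then f a b else f (\<sigma> a) (\<sigma> b))" for a b
  have g: "g v n = f z n" "g n v = f n z" "g v m = f z m" "g m v = f m z"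
    using E0 V by (auto simp: g_def \<sigma>_def insert_commute)
  have exg: "excess E0 g x i = excess E0 f x i" for x i by (rule excess_cong) (simp add: g_def)
  have "antiparallel_distinct (edges G) g"
    unfolding antiparallel_distinct_def
  proof (intro allI impI)
    fix a b assume ab: "{a, b} \<in> edges G"
    have fne: "f a b \<noteq> f b a" if "{a, b} \<in> edges ?H" for a b
      using f that by (auto simp: balanced_def antiparallel_distinct_def)
    show "g a b \<noteq> g b a"
    proof (cases "{a, b} \<in> E0")
      case True
      then show ?thesis using fne[of a b] by (simp add: g_def EH insert_commute)
    next
      case False
      then have "{a, b} = {v, n} \<or> {a, b} = {v, m}" using ab EG by auto
      then show ?thesis using fne[of z n] fne[of z m] g by (auto simp: EH doubleton_eq_iff)
    qed
  qed
  moreover have "excess (edges G) g x i = 0" for x i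
  proof -
    let ?d = "\<lambda>a b. of_bool (f a b = i) - of_bool (f b a = i) :: int"
    have G: "excess (edges G) g x i = excess E0 f x i +
        (of_bool (x = m) - of_bool (x = v)) * ?d z m + (of_bool (x = n) - of_bool (x = v)) * ?d z n"
      for x
      unfolding EG using E0 ne V by (simp add: excess_insert exg g)
    have H: "excess E0 f x i + (of_bool (x = m) - of_bool (x = z)) * ?d z m +
        (of_bool (x = n) - of_bool (x = z)) * ?d z n = 0" for x
    proof -
      have "excess (edges ?H) f x i = 0" using f by (simp add: balanced_def)
      then show ?thesis unfolding EH using E0 ne zn noz by (simp add: excess_insert)
    qed
    have "excess E0 f z i = 0" using noz by (simp add: excess_def)
    \<comment> \<open>The only edges at \<open>z\<close> are \<open>zn\<close> and
      \<open>zm\<close>, so balance at \<open>z\<close> makes their contributions cancel. The same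
      two terms appear at \<open>v\<close> after the identification.\<close>
    then have "?d z m + ?d z n = 0" using H[of z] zn by simp
    then show ?thesis using G[of x] H[of x] zn V \<open>excess E0 f z i = 0\<close> by (cases "x = v"; cases "x = z") auto
  qed
  ultimately have "balanced (edges G) g" by (simp add: balanced_def)
  then show False using not_balanced by blast
qed

text \<open>The cut of \<open>X\<close> in \<open>G - v\<close> is empty or a bridge;
  \<open>no_cutvertex\<close> excludes the former for nonempty proper \<open>X\<close>.\<close>

definition thin_cut :: "'a \<Rightarrow> 'a set \<Rightarrow> bool" where
  "thin_cut v X \<longleftrightarrow> (\<forall>a\<in>X. \<forall>b\<in>verts G - {v} - X. \<forall>a'\<in>X. \<forall>b'\<in>verts G - {v} - X.
       adj G a b \<longrightarrow> adj G a' b' \<longrightarrow> a = a' \<and> b = b')"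

lemma thin_cutD:
  assumes "thin_cut v X" "a \<in> X" "b \<in> verts G - {v} - X" "a' \<in> X" "b' \<in> verts G - {v} - X"
    "adj G a b" "adj G a' b'"
  shows "a = a' \<and> b = b'"
  using assms unfolding thin_cut_def by blast

text \<open>The split graph has a set \<open>Q\<close> avoiding \<open>v\<close> that at most one
  dart leaves. It contains \<open>z\<close>, as otherwise two darts of \<open>G\<close> leaving
  \<open>Q\<close> would persist. Connectedness of \<open>G - v\<close> supplies a dart leaving
  \<open>Q\<close> between vertices other than \<open>v\<close> and \<open>z\<close>. This uses up
  the only one, so no edge at \<open>z\<close> or at \<open>v\<close> crosses the cut.\<close>

lemma split_bad_cut:
  assumes z: "z \<notin> verts G" and nm: "adj G v n" "adj G v m" "n \<noteq> m"
    and pq: "adj G v p" "adj G v q" "p \<noteq> q" "p \<noteq> n" "p \<noteq> m" "q \<noteq> n" "q \<noteq> m"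
  shows "\<exists>X. X \<subseteq> verts G - {v} \<and> n \<in> X \<and> m \<in> X \<and> p \<notin> X \<and> q \<notin> X \<and>
    thin_cut v X"
proof -
  let ?H = "split_graph v z n m"
  have V: "v \<in> verts G" "n \<in> verts G" "m \<in> verts G" "p \<in> verts G" "q \<in> verts G"
    "v \<noteq> n" "v \<noteq> m" "v \<noteq> p" "v \<noteq> q"
    using adjD[OF simple] nm pq by metis+
  have zn: "z \<noteq> n" "z \<noteq> m" "z \<noteq> v" using z V by auto
  have simpH: "simple_graph ?H"
    using simple V zn unfolding simple_graph_def split_graph_def by auto
  have adjH: "adj ?H a b" if "adj G a b" "a \<noteq> v" "b \<noteq> v" for a b
    using that unfolding adj_split_graph by (auto simp: doubleton_eq_iff)
  have zH: "adj ?H z n" "adj ?H z m" unfolding adj_split_graph by auto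
  have vH: "adj ?H y v" if "adj G v y" "y \<noteq> n" "y \<noteq> m" for y
    using that V unfolding adj_split_graph by (auto simp: doubleton_eq_iff adj_sym)
  have VH: "verts ?H = insert z (verts G)" by (simp add: split_graph_def)
  have "\<not> (\<forall>Q. Q \<noteq> {} \<longrightarrow> Q \<subseteq> verts ?H - {v} \<longrightarrow> two_darts ?H Q (verts ?H - Q))"
    using split_graph_not_bridgeless[OF z nm] bridgelessI[OF simpH, of v] V zn unfolding VH by blast
  then obtain Q where Q: "Q \<noteq> {}" "Q \<subseteq> insert z (verts G) - {v}"
    "\<not> two_darts ?H Q (insert z (verts G) - Q)" unfolding VH by blast
  have uniq: "a = a' \<and> b = b'"
    if "a \<in> Q" "b \<in> insert z (verts G) - Q" "a' \<in> Q" "b' \<in> insert z (verts G) - Q"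
      "adj ?H a b" "adj ?H a' b'" for a b a' b'
    using Q(3) two_dartsI[of a Q b "insert z (verts G) - Q" a' b'] that by auto
  have zQ: "z \<in> Q"
  proof (rule ccontr)
    assume zQ: "z \<notin> Q"
    then have QV: "Q \<noteq> {}" "Q \<subset> verts G" using Q V by auto
    obtain a b a' b' where *: "a \<in> Q" "b \<in> verts G - Q" "a' \<in> Q" "b' \<in> verts G - Q"
      "adj G a b" "adj G a' b'" "(a, b) \<noteq> (a', b')"
      using bridgelessD[OF simple bridgeless QV] by (rule two_dartsE)
    \<comment> \<open>Follows the edges \<open>vn\<close> and \<open>vm\<close> to their new end
      \<open>z\<close>. Since \<open>z\<close> is not a vertex of \<open>G\<close>, different darts
      stay different.\<close>
    define \<phi> where "\<phi> a b = (if b = v \<and> (a = n \<or> a = m) then z else b)" for a b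
    have \<phi>: "\<phi> a b \<in> insert z (verts G) - Q \<and> adj ?H a (\<phi> a b)"
      if ab: "a \<in> Q" "b \<in> verts G - Q" "adj G a b" for a b
    proof (cases "b = v")
      case True
      then show ?thesis using ab zQ zH vH[of a] V by (auto simp: \<phi>_def adj_sym)
    next
      case False
      then show ?thesis using ab Q(2) adjH[of a b] by (auto simp: \<phi>_def)
    qed
    have "a = a' \<and> \<phi> a b = \<phi> a' b'" using * \<phi>[of a b] \<phi>[of a' b'] by (intro uniq) auto
    then show False using * z by (auto simp: \<phi>_def split: if_splits)
  qed
  define X where "X = Q - {z}"
  have XV: "X \<subseteq> verts G - {v}" using Q(2) by (auto simp: X_def)
  have vQ: "v \<in> insert z (verts G) - Q" using Q(2) V by auto
  have "n \<in> X \<or> m \<in> X"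
  proof (rule ccontr)
    assume "\<not> ?thesis"
    then have "n = m" using uniq[of z n z m] zQ zH V zn by (auto simp: X_def)
    then show False using nm by simp
  qed
  then have ne: "X \<noteq> {}" by auto
  have "p \<notin> X \<or> q \<notin> X"
  proof (rule ccontr)
    assume "\<not> ?thesis"
    then have "p = q" using uniq[of p v q v] vQ vH pq by (auto simp: X_def)
    then show False using pq by simp
  qed
  then have "X \<subset> verts G - {v}" using XV V by auto
  then obtain a b where ab: "a \<in> X" "b \<in> verts G - {v} - X" "adj G a b"
    using no_cutvertex[OF V(1) ne] by blast
  have aH: "a \<in> Q" "b \<in> insert z (verts G) - Q" "adj ?H a b" "a \<noteq> z" "b \<noteq> v"
    using ab adjH[of a b] XV z by (auto simp: X_def)
  \<comment> \<open>The dart from \<open>a\<close> to \<open>b\<close> is the only one leaving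
    \<open>Q\<close>; if \<open>n\<close> were outside, the dart from \<open>z\<close> to
    \<open>n\<close> would be another.\<close>
  have "n \<in> X" using uniq[of z n a b] zQ zH aH V zn by (auto simp: X_def)
  moreover have "m \<in> X" using uniq[of z m a b] zQ zH aH V zn by (auto simp: X_def)
  moreover have "y \<notin> X" if "adj G v y" "y \<noteq> n" "y \<noteq> m" for y
    using uniq[of y v a b] vQ vH[OF that] aH by (auto simp: X_def)
  then have "p \<notin> X" "q \<notin> X" using pq by auto
  moreover have "a = a' \<and> b = b'" if "a \<in> X" "b \<in> verts G - {v} - X" "a' \<in> X" "b' \<in> verts G - {v} - X"
    "adj G a b" "adj G a' b'" for a b a' b'
    using that adjH[of a b] adjH[of a' b'] XV z by (intro uniq) (auto simp: X_def)
  then have "thin_cut v X" unfolding thin_cut_def by blast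
  ultimately show ?thesis using XV by blast
qed

text \<open>Two crossing thin cuts divide the connected graph \<open>G - v\<close> into four nonempty quarters
  joined by at most two edges.\<close>

lemma crossing_cuts_aux:
  assumes v: "v \<in> verts G" and sub: "X \<subseteq> verts G - {v}" "Y \<subseteq> verts G - {v}"
    and X: "thin_cut v X"
    and Y: "thin_cut v Y"
    and I: "X \<inter> Y \<noteq> {}" and B: "X - Y \<noteq> {}" and C: "Y - X \<noteq> {}"
    and d: "c \<in> X" "d \<in> verts G - {v} - X - Y" "adj G d c"
  shows False
proof -
  let ?W = "verts G - {v}"
  have cd: "adj G c d" using d(3) adj_sym by metis
  have d': "d \<in> ?W - X" "d \<in> ?W - Y" using d by auto
  show False
  proof (cases "c \<in> Y")
    \<comment> \<open>Here \<open>cd\<close> is the only edge of \<open>G - v\<close> across either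
      cut, and it does not meet \<open>X - Y\<close>, so no edge can leave
      \<open>X - Y\<close>.\<close>
    case True
    have "X - Y \<subset> ?W" using sub d by auto
    then obtain a b where ab: "a \<in> X - Y" "b \<in> ?W - (X - Y)" "adj G a b"
      using no_cutvertex[OF v B] by blast
    show False
    proof (cases "b \<in> X")
      case True
      then have "b = c \<and> a = d" using ab \<open>c \<in> Y\<close> d' cd sub adj_sym[of G a b] by (intro thin_cutD[OF Y]) auto
      then show False using ab d by auto
    next
      case False
      then have "a = c \<and> b = d" using ab d d' cd by (intro thin_cutD[OF X]) auto
      then show False using ab True by auto
    qed
  next
    \<comment> \<open>Now \<open>cd\<close> uses up the cut of \<open>X\<close>. The edge leaving
      \<open>Y - X\<close> then has to use up the cut of \<open>Y\<close>, and none is left for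
      \<open>X \<inter> Y\<close>.\<close>
    case False
    have "Y - X \<subset> ?W" using sub d by auto
    then obtain a b where ab: "a \<in> Y - X" "b \<in> ?W - (Y - X)" "adj G a b"
      using no_cutvertex[OF v C] by blast
    have bX: "b \<notin> X"
    proof
      assume "b \<in> X"
      then have "b = c \<and> a = d" using ab d d' cd sub adj_sym[of G a b] by (intro thin_cutD[OF X]) auto
      then show False using ab d by auto
    qed
    have "X \<inter> Y \<subset> ?W" using sub d by auto
    then obtain a' b' where ab': "a' \<in> X \<inter> Y" "b' \<in> ?W - (X \<inter> Y)" "adj G a' b'"
      using no_cutvertex[OF v I] by blast
    show False
    proof (cases "b' \<in> X")
      case True
      then have "a' = a \<and> b' = b" using ab ab' bX by (intro thin_cutD[OF Y]) auto
      then show False using ab ab' by auto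
    next
      case False
      then have "a' = c \<and> b' = d" using ab' d d' cd by (intro thin_cutD[OF X]) auto
      then show False using ab' \<open>c \<notin> Y\<close> by auto
    qed
  qed
qed

text \<open>Splitting off \<open>n, m\<close> and splitting off \<open>n, p\<close> give thin cuts
  that put the four neighbours into the four different quarters. An edge leaving the quarter of
  \<open>q\<close> enters \<open>X\<close> or \<open>Y\<close>, and these cases are
  symmetric.\<close>

lemma no_four_nbrs:
  assumes z: "z \<notin> verts G"
    and nbrs: "adj G v n" "adj G v m" "adj G v p" "adj G v q"
    and dist: "distinct [n, m, p, q]"
  shows False
proof -
  have v: "v \<in> verts G" using adjD[OF simple nbrs(1)] by simp
  have q: "q \<in> verts G" "q \<noteq> v" using adjD[OF simple nbrs(4)] by auto
  obtain X where X: "X \<subseteq> verts G - {v}" "n \<in> X" "m \<in> X" "p \<notin> X" "q \<notin> X" "thin_cut v X"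
    using split_bad_cut[OF z nbrs(1,2) _ nbrs(3,4)] dist by auto
  obtain Y where Y: "Y \<subseteq> verts G - {v}" "n \<in> Y" "p \<in> Y" "m \<notin> Y" "q \<notin> Y" "thin_cut v Y"
    using split_bad_cut[OF z nbrs(1,3) _ nbrs(2,4)] dist by auto
  let ?W = "verts G - {v}"
  have "?W - X - Y \<noteq> {}" "?W - X - Y \<subset> ?W" using X Y q by auto
  from no_cutvertex[OF v this]
  obtain d c where dc: "d \<in> ?W - X - Y" "c \<in> ?W - (?W - X - Y)" "adj G d c" by auto
  then consider "c \<in> X" | "c \<in> Y" by auto
  then show False
  proof cases
    case 1
    show False
      by (rule crossing_cuts_aux[OF v X(1) Y(1) X(6) Y(6) _ _ _ 1 _ dc(3)]) (use X Y dc in auto)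
  next
    case 2
    show False
      by (rule crossing_cuts_aux[OF v Y(1) X(1) Y(6) X(6) _ _ _ 2 _ dc(3)]) (use X Y dc in auto)
  qed
qed

end

lemma extremal_map_graph:
  assumes "extremal_noncolorable G" "inj_on h (verts G)"
  shows "extremal_noncolorable (map_graph h G)"
proof -
  have G: "simple_graph G" "bridgeless_bipartite_noncolorable G"
    using assms(1) extremal_facts by (auto simp: extremal_noncolorable_def)
  show ?thesis
    using noncolorable_map_graph[OF G(1) assms(2) G(2)] assms(1)
    unfolding extremal_noncolorable_def card_map_graph[OF G(1) assms(2)] by auto
qed

context extremal
begin

text \<open>Splitting needs a vertex outside \<open>G\<close>, which the type of \<open>G\<close>
  might not offer; hence the passage to an extremal copy on \<open>nat\<close>.\<close>

lemma degree_le_3: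
  assumes "x \<in> verts G" shows "degree G x \<le> 3"
proof (rule ccontr)
  assume "\<not> degree G x \<le> 3"
  obtain h :: "'a \<Rightarrow> nat" where h: "inj_on h (verts G)" using inj_on_nat_ex[OF finite_V] .
  let ?H = "map_graph h G"
  interpret H: extremal ?H
    by unfold_locales (rule extremal_map_graph[OF extremal h])
  let ?N = "{u. {u, h x} \<in> edges ?H}"
  have "4 \<le> card ?N"
    using \<open>\<not> degree G x \<le> 3\<close> degree_map_graph[OF simple h assms] degree_eq_card_nbrs[OF H.simple] by simp
  then obtain T where T: "T \<subseteq> ?N" "card T = 4" by (rule obtain_subset_with_card_n)
  have "card T = Suc 3" using T by simp
  then obtain n B where B: "T = insert n B" "n \<notin> B" "card B = 3" unfolding card_Suc_eq by auto
  then obtain m p q where "B = {m, p, q}" "m \<noteq> p" "p \<noteq> q" "m \<noteq> q"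
    unfolding card_3_iff by auto
  then have nbrs: "{n, m, p, q} \<subseteq> ?N" "distinct [n, m, p, q]" using T B by auto
  obtain z where "z \<notin> verts ?H" using ex_new_if_finite[OF infinite_UNIV_nat H.finite_V] by auto
  then show False
    using nbrs H.no_four_nbrs[of z "h x" n m p q] by (auto simp: adj_def insert_commute)
qed

end

section \<open>Two-edge cuts\<close>

lemma balanced_normalise:
  assumes "balanced E f" "p \<noteq> q"
  shows "\<exists>g. balanced E g \<and> (\<forall>u v. (g u v = 0 \<longleftrightarrow> f u v = p) \<and> (g u v = 1 \<longleftrightarrow> f u v = q))"
proof -
  define \<pi> where "\<pi> n = (if n = p then 0 else if n = q then 1 else n + 2)" for n :: nat
  have "inj \<pi>" using assms(2) by (auto simp: inj_def \<pi>_def)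
  then have "balanced E (\<lambda>u v. \<pi> (f u v))" using balanced_inj assms(1) by blast
  moreover have "\<pi> n = 0 \<longleftrightarrow> n = p" "\<pi> n = 1 \<longleftrightarrow> n = q" for n using assms(2) by (auto simp: \<pi>_def)
  ultimately show ?thesis by (intro exI[of _ "\<lambda>u v. \<pi> (f u v)"]) simp
qed

text \<open>\<open>f\<close> colours one side of a two-edge cut as if colour \<open>0\<close> left it at \<open>s\<close> and
  came back at \<open>t\<close>, and colour \<open>1\<close> took the opposite route.\<close>

definition carries :: "'a set set \<Rightarrow> ('a \<Rightarrow> 'a \<Rightarrow> nat) \<Rightarrow> 'a \<Rightarrow> 'a \<Rightarrow> bool" where
  "carries E f s t \<longleftrightarrow> antiparallel_distinct E f \<and> (\<forall>x i. excess E f x i =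
     (of_bool (x = s) - of_bool (x = t)) * (of_bool (0 = i) - of_bool (1 = i)))"

text \<open>Nontriviality of the cut enters as \<open>a1 \<noteq> a2\<close> and
  \<open>b1 \<noteq> b2\<close>. The two sides play symmetric roles, so results about
  \<open>S\<close> apply to \<open>T\<close> by a second interpretation.\<close>

locale nontrivial_two_cut = extremal G for G :: "'a ugraph" +
  fixes S T a1 a2 b1 b2
  assumes ST: "S \<union> T = verts G" "S \<inter> T = {}"
    and ends: "a1 \<in> S" "a2 \<in> S" "b1 \<in> T" "b2 \<in> T" "a1 \<noteq> a2" "b1 \<noteq> b2"
    and cut: "adj G a1 b1" "adj G a2 b2"
    and only: "\<And>a b. a \<in> S \<Longrightarrow> b \<in> T \<Longrightarrow> adj G a b \<Longrightarrow> a = a1 \<and> b = b1 \<or> a = a2 \<and> b = b2"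
begin

abbreviation ES :: "'a set set" where "ES \<equiv> edges (induced G S)"

lemma ES_facts: "finite ES" "{a, b} \<in> ES \<longleftrightarrow> adj G a b \<and> a \<in> S \<and> b \<in> S"
  using finite_E by (auto simp: edges_induced adj_def)

lemma simple_S: "simple_graph (induced G S)"
  using ST by (intro simple_induced[OF simple]) auto

text \<open>Missing from \<open>ES\<close> are the two cut edges and a further edge at
  \<open>b1\<close>. The third makes room for the two edges added in
  \<open>carries_same_side\<close>.\<close>

lemma card_ES: "card ES + 3 \<le> card (edges G)"
proof -
  have "b1 \<in> verts G" using ST ends by auto
  then obtain y where y: "adj G b1 y" "y \<noteq> a1" by (rule other_nbr)
  have yS: "y \<notin> S" using only[of y b1] y ends adj_sym[of G b1 y] by auto
  have "insert {a1, b1} (insert {a2, b2} (insert {b1, y} ES)) \<subseteq> edges G"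
    using cut y by (auto simp: adj_def edges_induced)
  then have "card (insert {a1, b1} (insert {a2, b2} (insert {b1, y} ES))) \<le> card (edges G)"
    using finite_E by (rule card_mono[rotated])
  moreover have "b1 \<notin> S" "b2 \<notin> S" "a1 \<notin> T" "a2 \<notin> T" using ST ends by auto
  then have "{b1, y} \<notin> ES" "{a2, b2} \<notin> insert {b1, y} ES"
    "{a1, b1} \<notin> insert {a2, b2} (insert {b1, y} ES)"
    using ES_facts(2) yS ends y by (auto simp: doubleton_eq_iff)
  ultimately show ?thesis using ES_facts(1) by simp
qed

lemma darts_from:
  assumes "Q \<noteq> {}" "Q \<subseteq> S" "Q \<noteq> verts G"
  shows "two_darts G Q (verts G - Q)"
  using assms ST by (intro bridgelessD[OF simple bridgeless]) auto

text \<open>The side \<open>T\<close> is contracted to the single vertex \<open>b1\<close>, joined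
  to both \<open>a1\<close> and \<open>a2\<close>, which is consistent with the bipartition as the
  ends are in one class. Deleting \<open>b1\<close> from a balanced colouring leaves the required
  excess.\<close>

lemma carries_same_side:
  assumes A: "\<And>u v. adj G u v \<Longrightarrow> u \<in> A \<longleftrightarrow> v \<notin> A" and same: "a1 \<in> A \<longleftrightarrow> a2 \<in> A"
  shows "\<exists>f. carries ES f a1 a2"
proof -
  define H where "H = \<lparr>verts = insert b1 S, edges = insert {a1, b1} (insert {a2, b1} ES)\<rparr>"
  have b1: "b1 \<notin> S" "b2 \<notin> S" "a1 \<noteq> b1" "a2 \<noteq> b1" using ST ends by auto
  have adjH: "adj H u v \<longleftrightarrow> adj G u v \<and> u \<in> S \<and> v \<in> S \<or> {u, v} = {a1, b1} \<or> {u, v} = {a2, b1}" for u v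
    using ES_facts(2)[of u v] by (auto simp: adj_def H_def)
  have VH: "verts H = insert b1 S" by (simp add: H_def)
  have simpH: "simple_graph H"
    using simple_S b1 ends unfolding simple_graph_def H_def by auto
  have "bipartite H"
  proof (rule bipartite_sideI[OF simpH])
    fix u v assume "adj H u v"
    then show "u \<in> A \<longleftrightarrow> v \<notin> A"
      using A[of u v] A[OF cut(1)] same unfolding adjH by (auto simp: doubleton_eq_iff)
  qed
  moreover have "bridgeless H"
  proof (rule bridgelessI[OF simpH, of b1])
    show "b1 \<in> verts H" "verts H \<noteq> {b1}" using ends b1 by (auto simp: VH)
    fix Q assume Q: "Q \<noteq> {}" "Q \<subseteq> verts H - {b1}"
    then have QS: "Q \<subseteq> S" "Q \<noteq> verts G" using ST ends by (auto simp: VH)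
    obtain a b a' b' where *: "a \<in> Q" "b \<in> verts G - Q" "a' \<in> Q" "b' \<in> verts G - Q"
      "adj G a b" "adj G a' b'" "(a, b) \<noteq> (a', b')"
      using darts_from[OF Q(1) QS] by (rule two_dartsE)
    define \<phi> where "\<phi> b = (if b \<in> S then b else b1)" for b
    have \<phi>: "\<phi> b \<in> verts H - Q \<and> adj H a (\<phi> b)" if ab: "a \<in> Q" "b \<in> verts G - Q" "adj G a b" for a b
    proof (cases "b \<in> S")
      case True
      then show ?thesis using ab QS by (auto simp: \<phi>_def adjH VH)
    next
      case False
      then have "a = a1 \<or> a = a2" using only[of a b] ab QS ST by auto
      then show ?thesis using False ab QS b1 by (auto simp: \<phi>_def adjH VH)
    qed
    have "b = b'" if "a = a'" "\<phi> b = \<phi> b'"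
      using that only[of a b] only[of a' b'] * QS ST b1 ends by (auto simp: \<phi>_def split: if_splits)
    then show "two_darts H Q (verts H - Q)"
      using * \<phi>[of a b] \<phi>[of a' b'] by (intro two_dartsI[of a Q "\<phi> b" _ a' "\<phi> b'"]) auto
  qed
  moreover have "card (edges H) < card (edges G)"
  proof -
    have "card (edges H) \<le> card ES + 2"
      unfolding H_def using ES_facts(1) by (simp add: card_insert_if)
    then show ?thesis using card_ES by simp
  qed
  ultimately obtain f where f: "balanced (edges H) f" using smaller_balanced[OF simpH] by blast
  have "f a1 b1 \<noteq> f b1 a1" using f by (auto simp: balanced_def antiparallel_distinct_def H_def)
  from balanced_normalise[OF f this]
  obtain g where g: "balanced (edges H) g" "g a1 b1 = 0" "g b1 a1 = 1" by auto
  have notES: "{a1, b1} \<notin> insert {a2, b1} ES" "{a2, b1} \<notin> ES"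
    using ES_facts(2) b1 ends by (auto simp: doubleton_eq_iff)
  have ex: "excess ES g x i
      + (of_bool (x = b1) - of_bool (x = a2)) * (of_bool (g a2 b1 = i) - of_bool (g b1 a2 = i))
      + (of_bool (x = b1) - of_bool (x = a1)) * (of_bool (0 = i) - of_bool (1 = i)) = 0" for x i
  proof -
    have "excess (edges H) g x i = 0" using g by (simp add: balanced_def)
    then show ?thesis
      using notES ES_facts(1) b1 g(2,3) by (simp add: H_def excess_insert)
  qed
  have "excess ES g b1 i = 0" for i using ES_facts(2) b1 by (simp add: excess_def)
  \<comment> \<open>\<open>b1\<close> has only two edges, so the colours 0 and 1 on one of them
    determine, by balance, those on the other.\<close>
  then have at_b1: "of_bool (g a2 b1 = i) - of_bool (g b1 a2 = i) = of_bool (1 = i) - (of_bool (0 = i) :: int)" for i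
    using ex[of b1 i] b1 by simp
  have "excess ES g x i = (of_bool (x = a1) - of_bool (x = a2)) * (of_bool (0 = i) - of_bool (1 = i))" for x i
  proof (cases "x = b1")
    case True
    then show ?thesis using \<open>\<And>i. excess ES g b1 i = 0\<close> b1 by simp
  next
    case False
    then show ?thesis using ex[of x i] unfolding at_b1 by (simp add: algebra_simps)
  qed
  moreover have "antiparallel_distinct ES g"
    using g(1) by (auto simp: balanced_def antiparallel_distinct_def H_def)
  ultimately show ?thesis unfolding carries_def by blast
qed

text \<open>The edge \<open>a1 a2\<close> stands for the detour through \<open>T\<close>. It joins
  different classes, and as it is not in \<open>G\<close>, a dart rerouted onto it coincides with no
  old dart.\<close>

lemma carries_nonadjacent:
  assumes A: "\<And>u v. adj G u v \<Longrightarrow> u \<in> A \<longleftrightarrow> v \<notin> A" and diff: "a1 \<in> A \<longleftrightarrow> a2 \<notin> A"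
    and nadj: "\<not> adj G a1 a2"
  shows "\<exists>f. carries ES f a1 a2"
proof -
  define H where "H = \<lparr>verts = S, edges = insert {a1, a2} ES\<rparr>"
  have b1: "b1 \<notin> S" "b2 \<notin> S" using ST ends by auto
  have adjH: "adj H u v \<longleftrightarrow> adj G u v \<and> u \<in> S \<and> v \<in> S \<or> {u, v} = {a1, a2}" for u v
    using ES_facts(2)[of u v] by (auto simp: adj_def H_def)
  have VH: "verts H = S" by (simp add: H_def)
  have simpH: "simple_graph H"
    using simple_S ends unfolding simple_graph_def H_def by auto
  have "bipartite H"
  proof (rule bipartite_sideI[OF simpH])
    fix u v assume "adj H u v"
    then show "u \<in> A \<longleftrightarrow> v \<notin> A"
      using A[of u v] diff unfolding adjH by (auto simp: doubleton_eq_iff)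
  qed
  moreover have "bridgeless H"
  proof (rule bridgelessI[OF simpH, of a1])
    show "a1 \<in> verts H" "verts H \<noteq> {a1}" using ends by (auto simp: H_def)
    fix Q assume Q: "Q \<noteq> {}" "Q \<subseteq> verts H - {a1}"
    then have QS: "Q \<subseteq> S" "Q \<noteq> verts G" "a1 \<notin> Q" using ST ends by (auto simp: VH)
    obtain a b a' b' where *: "a \<in> Q" "b \<in> verts G - Q" "a' \<in> Q" "b' \<in> verts G - Q"
      "adj G a b" "adj G a' b'" "(a, b) \<noteq> (a', b')"
      using darts_from[OF Q(1) QS(1,2)] by (rule two_dartsE)
    define \<phi> where "\<phi> b = (if b \<in> S then b else a1)" for b
    have out: "a = a2 \<and> b = b2" if "a \<in> Q" "b \<in> verts G" "b \<notin> S" "adj G a b" for a b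
      using only[of a b] that QS ST by auto
    have \<phi>: "\<phi> b \<in> verts H - Q \<and> adj H a (\<phi> b)" if ab: "a \<in> Q" "b \<in> verts G - Q" "adj G a b" for a b
      using ab QS ends out[of a b] by (auto simp: \<phi>_def adjH VH)
    have "b = b'" if "a = a'" "\<phi> b = \<phi> b'"
      using that out[of a b] out[of a' b'] * nadj adj_sym[of G a1 a2]
      by (auto simp: \<phi>_def split: if_splits)
    then show "two_darts H Q (verts H - Q)"
      using * \<phi>[of a b] \<phi>[of a' b'] by (intro two_dartsI[of a Q "\<phi> b" _ a' "\<phi> b'"]) auto
  qed
  moreover have "card (edges H) < card (edges G)"
  proof -
    have "card (edges H) \<le> card ES + 1"
      unfolding H_def using ES_facts(1) by (simp add: card_insert_if)
    then show ?thesis using card_ES by simp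
  qed
  ultimately obtain f where f: "balanced (edges H) f" using smaller_balanced[OF simpH] by blast
  have "f a1 a2 \<noteq> f a2 a1" using f by (auto simp: balanced_def antiparallel_distinct_def H_def)
  from balanced_normalise[OF f this]
  obtain g where g: "balanced (edges H) g" "g a1 a2 = 0" "g a2 a1 = 1" by auto
  have "excess ES g x i = (of_bool (x = a1) - of_bool (x = a2)) * (of_bool (0 = i) - of_bool (1 = i))" for x i
  proof -
    have "excess (edges H) g x i = 0" using g by (simp add: balanced_def)
    moreover have "{a1, a2} \<notin> ES" using nadj ES_facts(2) by simp
    ultimately show ?thesis
      using ES_facts(1) ends g(2,3) by (simp add: H_def excess_insert algebra_simps)
  qed
  moreover have "antiparallel_distinct ES g"
    using g(1) by (auto simp: balanced_def antiparallel_distinct_def H_def)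
  ultimately show ?thesis unfolding carries_def by blast
qed

text \<open>A single edge is itself a bridge, so minimality does not apply; colour 1 on the dart
  from \<open>a1\<close> and colour 0 on the reverse dart already do.\<close>

lemma carries_edge:
  assumes "S = {a1, a2}" "adj G a1 a2"
  shows "\<exists>f. carries ES f a1 a2"
proof -
  define f where "f u v = (if u = a1 then 1 else 0 :: nat)" for u v :: 'a
  have ES: "ES = {{a1, a2}}"
  proof (intro equalityI subsetI)
    fix e assume e: "e \<in> ES"
    then have "e \<in> edges (induced G S)" .
    from simple_edgeE[OF simple_S this] obtain u v where "e = {u, v}" "u \<noteq> v" "u \<in> S" "v \<in> S"
      by auto
    then show "e \<in> {{a1, a2}}" using assms(1) by auto
  qed (use assms ES_facts(2) ends in auto)
  have "excess ES f x i = (of_bool (x = a1) - of_bool (x = a2)) * (of_bool (0 = i) - of_bool (1 = i))" for x i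
    unfolding ES excess_edge[OF ends(5)] using ends(5) by (simp add: f_def algebra_simps)
  moreover have "antiparallel_distinct ES f"
    unfolding ES antiparallel_distinct_def using ends(5) by (auto simp: f_def doubleton_eq_iff)
  ultimately show ?thesis unfolding carries_def by blast
qed

text \<open>Take a set \<open>Q\<close> avoiding the root \<open>a1\<close>. If \<open>a2\<close> is
  outside \<open>Q\<close>, no cut edge of \<open>G\<close> leaves \<open>Q\<close>. Otherwise the
  edge \<open>a2 a1\<close> gives one dart, and a second comes from connectedness of
  \<open>G - a2\<close>, or of \<open>G - a1\<close> when \<open>Q\<close> is just
  \<open>{a2}\<close>.\<close>

lemma bridgeless_adjacent:
  assumes "S \<noteq> {a1, a2}" "adj G a1 a2"
  shows "bridgeless (induced G S)"
proof (rule bridgelessI[OF simple_S, of a1])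
  show "a1 \<in> verts (induced G S)" "verts (induced G S) \<noteq> {a1}" using ends by auto
  fix Q assume "Q \<noteq> {}" "Q \<subseteq> verts (induced G S) - {a1}"
  then have Q: "Q \<noteq> {}" "Q \<subseteq> S" "a1 \<notin> Q" "Q \<noteq> verts G" using ST ends by auto
  have bS: "b1 \<notin> S" "b2 \<notin> S" using ST ends by auto
  show "two_darts (induced G S) Q (verts (induced G S) - Q)"
  proof (cases "a2 \<in> Q")
    case False
    obtain a b a' b' where *: "a \<in> Q" "b \<in> verts G - Q" "a' \<in> Q" "b' \<in> verts G - Q"
      "adj G a b" "adj G a' b'" "(a, b) \<noteq> (a', b')"
      using darts_from[OF Q(1,2,4)] by (rule two_dartsE)
    have "b \<in> S" if "a \<in> Q" "b \<in> verts G" "adj G a b" for a b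
      using only[of a b] that Q ST False by auto
    then have "b \<in> S" "b' \<in> S" using * by auto
    then show ?thesis
      using * unfolding verts_induced by (intro two_dartsI[of a Q b _ a' b']) (use Q in \<open>auto simp: adj_induced\<close>)
  next
    case True
    have V: "a1 \<in> verts G" "a2 \<in> verts G" using ST ends by auto
    have "\<exists>a\<in>Q. \<exists>b\<in>S - Q. adj G a b \<and> (a, b) \<noteq> (a2, a1)"
    proof (cases "Q = {a2}")
      case False
      then have "Q - {a2} \<noteq> {}" "Q - {a2} \<subset> verts G - {a2}" using Q(1,2,3) ST V ends True by auto
      from no_cutvertex[OF V(2) this] obtain a b
        where ab: "a \<in> Q - {a2}" "b \<in> verts G - {a2} - (Q - {a2})" "adj G a b" by auto
      then have "b \<in> S" using only[of a b] Q ST by auto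
      then show ?thesis using ab by (intro bexI[of _ a] bexI[of _ b]) auto
    next
      case True
      have ne: "S - {a1, a2} \<noteq> {}" using assms(1) ends by auto
      moreover have "S - {a1, a2} \<subset> verts G - {a1}" using V ST ends by auto
      ultimately obtain a b
        where ab: "a \<in> S - {a1, a2}" "b \<in> verts G - {a1} - (S - {a1, a2})" "adj G a b"
        using no_cutvertex[OF V(1), of "S - {a1, a2}"] by auto
      have "b \<in> S" using only[of a b] ab ST by auto
      then have "b = a2" using ab by auto
      then show ?thesis using ab True adj_sym[of G a b] by (intro bexI[of _ b] bexI[of _ a]) auto
    qed
    then obtain a b where "a \<in> Q" "b \<in> S - Q" "adj G a b" "(a, b) \<noteq> (a2, a1)" by auto
    moreover have "adj G a2 a1" using assms(2) adj_sym by metis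
    ultimately show ?thesis
      unfolding verts_induced using True Q ends
      by (intro two_dartsI[of a Q b _ a2 a1]) (auto simp: adj_induced)
  qed
qed

lemma carries_adjacent:
  assumes "S \<noteq> {a1, a2}" "adj G a1 a2"
  shows "\<exists>f. carries ES f a1 a2"
proof -
  have "S \<subseteq> verts G" using ST by auto
  then obtain f where f: "balanced ES f"
    using smaller_balanced[OF simple_S bridgeless_adjacent[OF assms] bipartite_induced[OF simple bipartite]]
      card_ES by auto
  obtain q where q: "q \<notin> colours_used ES f"
    using ex_new_if_finite[OF infinite_UNIV_nat card_colours_used(1)[OF ES_facts(1)]] by auto
  have a: "{a1, a2} \<in> ES" "{a2, a1} \<in> ES" using ES_facts(2) assms(2) ends adj_sym[of G a1 a2] by auto
  have "f a1 a2 \<noteq> q" using colours_usedI[OF a(1), of f] q by auto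
  from balanced_normalise[OF f this] obtain g where g: "balanced ES g" "g a1 a2 = 0"
    "\<And>u v. g u v = 1 \<longleftrightarrow> f u v = q" by auto
  have g1: "g u v \<noteq> 1" if "{u, v} \<in> ES" for u v
    using g(3)[of u v] q colours_usedI[OF that, of f] by auto
  define h where "h u v = (if u = a1 \<and> v = a2 then 1 else g u v)" for u v
  define E0 where "E0 = ES - {{a1, a2}}"
  have E0: "ES = insert {a1, a2} E0" "{a1, a2} \<notin> E0" "finite E0" using a ES_facts(1) by (auto simp: E0_def)
  have "excess ES h x i = (of_bool (x = a1) - of_bool (x = a2)) * (of_bool (0 = i) - of_bool (1 = i))" for x i
  proof -
    let ?d = "of_bool (x = a2) - of_bool (x = a1) :: int"
    have "excess E0 h x i = excess E0 g x i"
      using E0(2) by (intro excess_cong) (auto simp: h_def)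
    then have 1: "excess ES h x i = excess E0 g x i + ?d * (of_bool (1 = i) - of_bool (g a2 a1 = i))"
      unfolding E0(1) excess_insert[OF E0(3,2) ends(5)] using ends(5) by (simp add: h_def)
    have "excess ES g x i = 0" using g by (simp add: balanced_def)
    then have 2: "excess E0 g x i + ?d * (of_bool (0 = i) - of_bool (g a2 a1 = i)) = 0"
      unfolding E0(1) excess_insert[OF E0(3,2) ends(5)] g(2) .
    show ?thesis using 2 unfolding 1 by (simp add: algebra_simps)
  qed
  moreover have "antiparallel_distinct ES h"
    unfolding antiparallel_distinct_def
  proof (intro allI impI)
    fix u v assume uv: "{u, v} \<in> ES"
    then have "g u v \<noteq> g v u" using g(1) by (simp add: balanced_def antiparallel_distinct_def)
    moreover have "g u v \<noteq> 1" "g v u \<noteq> 1" using g1[of u v] g1[of v u] uv by (simp_all add: insert_commute)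
    ultimately show "h u v \<noteq> h v u" using ends(5) unfolding h_def by metis
  qed
  ultimately show ?thesis unfolding carries_def by blast
qed

lemma carries_side: "\<exists>f. carries ES f a1 a2"
proof -
  obtain A where A: "\<And>u v. adj G u v \<Longrightarrow> u \<in> A \<longleftrightarrow> v \<notin> A"
    using bipartite_side[OF bipartite] by metis
  show ?thesis
    using carries_same_side[OF A] carries_nonadjacent[OF A] carries_edge carries_adjacent by blast
qed

end

text \<open>The second interpretation lists the ends as \<open>b2, b1\<close>: colour 0 leaves
  \<open>S\<close> along \<open>a1 b1\<close>, so it must leave \<open>T\<close> at
  \<open>b2\<close> to return along \<open>b2 a2\<close>. Colour 1 runs the same way backwards, and
  \<open>k\<close> colours the two cut edges accordingly.\<close>

lemma (in nontrivial_two_cut) no_nontrivial_two_cut: False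
proof -
  interpret other: nontrivial_two_cut G T S b2 b1 a2 a1
  proof unfold_locales
    show "adj G b2 a2" "adj G b1 a1" using cut adj_sym by metis+
    show "a = b2 \<and> b = a2 \<or> a = b1 \<and> b = a1" if "a \<in> T" "b \<in> S" "adj G a b" for a b
      using only[of b a] that adj_sym[of G a b] by auto
  qed (use ST ends in auto)
  obtain f where f: "carries ES f a1 a2" using carries_side by auto
  obtain g where g: "carries other.ES g b2 b1" using other.carries_side by auto
  have neq: "a1 \<noteq> b1" "a2 \<noteq> b2" "a1 \<noteq> b2" "a2 \<noteq> b1" using ST ends by auto
  define k where "k u v = (if u = b1 \<or> v = b1 then of_bool (u = b1) else of_bool (u = a2) :: nat)" for u v :: 'a
  have k: "k a1 b1 = 0" "k b1 a1 = 1" "k b2 a2 = 0" "k a2 b2 = 1"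
    using neq ends by (auto simp: k_def)
  let ?F = "insert {a1, b1} {{a2, b2}}"
  have ne: "{a1, b1} \<notin> {{a2, b2}}" using ends neq by (auto simp: doubleton_eq_iff)
  have exk: "excess ?F k x i = (of_bool (x = b2) - of_bool (x = a2)) * (of_bool (1 = i) - of_bool (0 = i))
      + (of_bool (x = b1) - of_bool (x = a1)) * (of_bool (0 = i) - of_bool (1 = i))" for x i
    using excess_insert[OF _ ne neq(1), of k x i] excess_edge[OF neq(2), of k x i] k by simp
  have apk: "antiparallel_distinct ?F k"
    using k by (auto simp: antiparallel_distinct_def doubleton_eq_iff)
  have disj: "ES \<inter> other.ES = {}" "(ES \<union> other.ES) \<inter> ?F = {}"
  proof -
    have "e \<noteq> {}" if "e \<in> edges G" for e using that simple by (auto simp: simple_graph_def)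
    then show "ES \<inter> other.ES = {}" using ST by (fastforce simp: edges_induced)
    show "(ES \<union> other.ES) \<inter> ?F = {}" using ST ends by (auto simp: edges_induced)
  qed
  have E: "edges G = (ES \<union> other.ES) \<union> ?F"
  proof (intro equalityI subsetI)
    fix e assume e: "e \<in> edges G"
    obtain u v where uv: "e = {u, v}" "u \<in> verts G" "v \<in> verts G" using simple_edgeE[OF simple e] by metis
    have ad: "adj G u v" "adj G v u" using e uv by (auto simp: adj_def insert_commute)
    consider "u \<in> S" "v \<in> S" | "u \<in> S" "v \<in> T" | "u \<in> T" "v \<in> S" | "u \<in> T" "v \<in> T"
      using uv ST by auto
    then show "e \<in> (ES \<union> other.ES) \<union> ?F"
      using only[of u v] only[of v u] ad e uv by cases (auto simp: edges_induced)
  qed (use cut in \<open>auto simp: edges_induced adj_def\<close>)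
  define l where "l = glue (ES \<union> other.ES) (glue ES f g) k"
  have "antiparallel_distinct (edges G) l"
    unfolding E l_def using f g apk by (intro antiparallel_distinct_glue) (auto simp: carries_def)
  moreover have "excess (edges G) l x i = 0" for x i
  proof -
    have "excess (edges G) l x i = excess ES f x i + excess other.ES g x i + excess ?F k x i"
      unfolding E l_def using ES_facts(1) other.ES_facts(1)
      by (subst excess_glue[OF _ _ disj(2)], simp_all only: finite_Un finite_insert finite.emptyI simp_thms
          excess_glue[OF _ _ disj(1)])
    also have "\<dots> = 0"
    proof -
      have "excess ES f x i = (of_bool (x = a1) - of_bool (x = a2)) * (of_bool (0 = i) - of_bool (1 = i))"
        "excess other.ES g x i = (of_bool (x = b2) - of_bool (x = b1)) * (of_bool (0 = i) - of_bool (1 = i))"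
        using f g unfolding carries_def by auto
      then show ?thesis unfolding exk by algebra
    qed
    finally show ?thesis .
  qed
  ultimately have "balanced (edges G) l" by (simp add: balanced_def)
  then show False using not_balanced by blast
qed

section \<open>Vertices of degree two\<close>

text \<open>The balance condition says that the two triples agree as multisets. If the conclusion
  fails, \<open>a\<close> can only be matched with \<open>c'\<close> and \<open>a'\<close> only with
  \<open>c\<close>, which leaves \<open>b = b'\<close>.\<close>

lemma derangement_of_three:
  fixes a b c a' b' c' :: nat
  assumes ne: "a \<noteq> a'" "b \<noteq> b'" "c \<noteq> c'"
    and bal: "\<And>i. of_bool (a = i) - of_bool (a' = i) + (of_bool (b = i) - of_bool (b' = i))
      + (of_bool (c = i) - of_bool (c' = i)) = (0 :: int)"
  shows "a = b' \<or> b = a'"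
proof (rule ccontr)
  assume "\<not> ?thesis"
  then have n: "b' \<noteq> a" "b \<noteq> a'" by auto
  have "c' = a" using bal[of a] n ne by (cases "c' = a") (auto simp: of_bool_def split: if_splits)
  moreover have "c = a'" using bal[of a'] n ne by (cases "c = a'") (auto simp: of_bool_def split: if_splits)
  ultimately show False using bal[of b] n ne by (auto simp: of_bool_def split: if_splits)
qed

context extremal
begin

section \<open>Every two-edge cut is trivial\<close>

lemma trivial_edge_cutD:
  assumes "trivial_edge_cut G F"
  obtains z where "z \<in> verts G" "\<And>y. adj G z y \<Longrightarrow> {z, y} \<in> F"
proof -
  have [simp]: "verts (del_edges G F) = verts G" by (simp add: del_edges_def)
  obtain z v where zv: "v \<in> verts G" "{z} = {u \<in> verts G. reachable (del_edges G F) v u}"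
    using assms unfolding trivial_edge_cut_def components_def by auto
  have "reachable (del_edges G F) v v" by (simp add: reachable_def)
  then have "v = z" using zv by auto
  have "{z, y} \<in> F" if "adj G z y" for y
  proof (rule ccontr)
    assume "{z, y} \<notin> F"
    then have "reachable (del_edges G F) v y"
      using that \<open>v = z\<close> by (auto simp: reachable_def del_edges_def adj_def)
    then have "y = z" using zv adjD(2)[OF simple that] by auto
    then show False using adjD(3)[OF simple that] by simp
  qed
  then show thesis using that zv(1) \<open>v = z\<close> by auto
qed

lemma trivial_edge_cutI:
  assumes "edge_cut G F" "z \<in> verts G" "\<And>y. adj G z y \<Longrightarrow> {z, y} \<in> F"
  shows "trivial_edge_cut G F"
proof -
  have "u = z" if "reachable (del_edges G F) z u" for u
    using that unfolding reachable_def
  proof (induction rule: rtranclp_induct)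
    case (step y w)
    then show ?case using assms(3)[of w] by (auto simp: del_edges_def adj_def)
  qed simp
  moreover have "reachable (del_edges G F) z z" by (simp add: reachable_def)
  ultimately have "{u \<in> verts G. reachable (del_edges G F) z u} = {z}" using assms(2) by auto
  then have "{z} \<in> components (del_edges G F)"
    using assms(2) unfolding components_def by (auto simp: del_edges_def)
  then show ?thesis using assms(1) unfolding trivial_edge_cut_def by auto
qed

text \<open>If both edges met at \<open>a1\<close>, nontriviality would give \<open>a1\<close> a
  further neighbour inside \<open>S\<close>, and \<open>a1\<close> would separate
  \<open>S - {a1}\<close> from \<open>T\<close>, against \<open>no_cutvertex\<close>.\<close>

lemma distinct_ends_of_nontrivial_cut:
  assumes ST: "S \<union> T = verts G" "S \<inter> T = {}" and T: "T \<noteq> {}"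
    and ends: "a1 \<in> S" "b1 \<in> T" "b2 \<in> T" "adj G a1 b1" "adj G a2 b2"
    and only: "\<And>a b. a \<in> S \<Longrightarrow> b \<in> T \<Longrightarrow> adj G a b \<Longrightarrow> a = a1 \<and> b = b1 \<or> a = a2 \<and> b = b2"
    and nontriv: "\<not> (\<exists>z\<in>verts G. \<forall>y. adj G z y \<longrightarrow> {z, y} \<in> {{a1, b1}, {a2, b2}})"
  shows "a1 \<noteq> a2"
proof
  assume eq: "a1 = a2"
  have aV: "a1 \<in> verts G" using ST ends by auto
  with nontriv have "\<exists>y. adj G a1 y \<and> {a1, y} \<notin> {{a1, b1}, {a2, b2}}" by blast
  then obtain y where y: "adj G a1 y" "{a1, y} \<notin> {{a1, b1}, {a2, b2}}" by (elim exE conjE)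
  then have "y \<notin> T" using only[of a1 y] ends by auto
  then have "y \<in> S - {a1}" using adjD[OF simple y(1)] ST by auto
  moreover have "S - {a1} \<subset> verts G - {a1}" using ST T ends aV by auto
  ultimately obtain a b where ab: "a \<in> S - {a1}" "b \<in> verts G - {a1} - (S - {a1})" "adj G a b"
    using no_cutvertex[OF aV, of "S - {a1}"] by auto
  then have "b \<in> T" using ST by auto
  then show False using only[of a b] ab eq by auto
qed

lemma two_edge_cut_trivial:
  assumes F: "edge_cut G F" "card F = 2" shows "trivial_edge_cut G F"
proof (rule ccontr)
  assume nt: "\<not> trivial_edge_cut G F"
  obtain S where S: "S \<noteq> {}" "S \<subset> verts G" "F = cut_edges G S" using F(1) by (auto simp: edge_cut_def)
  define T where "T = verts G - S"
  obtain e1 e2 where e: "F = {e1, e2}" "e1 \<noteq> e2" using F(2) by (auto simp: card_2_iff)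
  have eS: "e1 \<in> cut_edges G S" "e2 \<in> cut_edges G S" using e(1) S(3) by auto
  obtain a1 b1 where 1: "a1 \<in> S" "b1 \<in> T" "adj G a1 b1" "e1 = {a1, b1}"
    using eS(1) unfolding T_def by (rule cut_edgesE)
  obtain a2 b2 where 2: "a2 \<in> S" "b2 \<in> T" "adj G a2 b2" "e2 = {a2, b2}"
    using eS(2) unfolding T_def by (rule cut_edgesE)
  have ST: "S \<union> T = verts G" "S \<inter> T = {}" using S by (auto simp: T_def)
  have only: "a = a1 \<and> b = b1 \<or> a = a2 \<and> b = b2" if "a \<in> S" "b \<in> T" "adj G a b" for a b
  proof -
    have "{a, b} \<in> F" using that S(3) cut_edgesI[of a S b G] by (simp add: T_def)
    then show ?thesis using e 1 2 that ST by (auto simp: doubleton_eq_iff)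
  qed
  have nontriv: "\<not> (\<exists>z\<in>verts G. \<forall>y. adj G z y \<longrightarrow> {z, y} \<in> F)"
    using nt trivial_edge_cutI[OF F(1)] by blast
  have F12: "F = {{a1, b1}, {a2, b2}}" "F = {{b1, a1}, {b2, a2}}"
    using e 1 2 by (auto simp: insert_commute)
  have "a1 \<noteq> a2"
    using distinct_ends_of_nontrivial_cut[OF ST _ 1(1,2) 2(2) 1(3) 2(3) only] nontriv 1 F12(1) by auto
  moreover have "b1 \<noteq> b2"
  proof (rule distinct_ends_of_nontrivial_cut[of T S b1 a1 a2 b2])
    show "adj G b1 a1" "adj G b2 a2" using 1 2 adj_sym by metis+
    show "a = b1 \<and> b = a1 \<or> a = b2 \<and> b = a2" if "a \<in> T" "b \<in> S" "adj G a b" for a b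
      using only[of b a] that adj_sym[of G a b] by auto
  qed (use ST S 1 2 nontriv F12(2) in auto)
  ultimately interpret nontrivial_two_cut G S T a1 a2 b1 b2
    using ST 1 2 only by unfold_locales auto
  show False by (rule no_nontrivial_two_cut)
qed

section \<open>Degrees and 2-connectedness\<close>

lemma degree_ge_2:
  assumes "x \<in> verts G" shows "2 \<le> degree G x"
proof -
  obtain y where y: "adj G x y" using other_nbr[OF assms] .
  obtain w where w: "adj G x w" "w \<noteq> y" using other_nbr[OF assms] .
  have "{y, w} \<subseteq> {u. {u, x} \<in> edges G}" using y w by (auto simp: adj_def insert_commute)
  then have "card {y, w} \<le> card {u. {u, x} \<in> edges G}"
    using finite_nbrs[OF finite_E] by (rule card_mono[rotated])
  then show ?thesis using w degree_eq_card_nbrs[OF simple] by simp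
qed

lemma verts_nonempty: "verts G \<noteq> {}"
  using bridgeless bridgeless_iff[OF simple] by auto

lemma not_regular: "\<exists>x\<in>verts G. degree G x \<noteq> k"
proof (rule ccontr)
  assume "\<not> ?thesis"
  then have k: "degree G x = k" if "x \<in> verts G" for x using that by auto
  then have "2 \<le> k" using verts_nonempty degree_ge_2 by fastforce
  then show False
    using regular_colorable[OF simple bipartite _ k] extremal_facts(4)[OF extremal] by auto
qed

lemma min_degree_eq: "min_degree G = 2" and max_degree_eq: "max_degree G = 3"
proof -
  have range: "degree G x = 2 \<or> degree G x = 3" if "x \<in> verts G" for x
    using degree_ge_2[OF that] degree_le_3[OF that] by linarith
  obtain x where "x \<in> verts G" "degree G x \<noteq> 3" using not_regular[of 3] by auto
  then have x: "x \<in> verts G" "degree G x = 2" using range by auto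
  obtain y where "y \<in> verts G" "degree G y \<noteq> 2" using not_regular[of 2] by auto
  then have y: "y \<in> verts G" "degree G y = 3" using range by auto
  show "min_degree G = 2"
    unfolding min_degree_def using x finite_V degree_ge_2 by (intro Min_eqI) (auto intro: rev_image_eqI)
  show "max_degree G = 3"
    unfolding max_degree_def using y finite_V degree_le_3 by (intro Max_eqI) (auto intro: rev_image_eqI)
qed

lemma two_connected: "k_connected 2 G"
  unfolding k_connected_def
proof (intro conjI allI impI)
  obtain v where v: "v \<in> verts G" using verts_nonempty by auto
  obtain y where y: "adj G v y" using other_nbr[OF v] .
  obtain w where w: "adj G v w" "w \<noteq> y" using other_nbr[OF v] .
  have "v \<noteq> y" "v \<noteq> w" using adjD(3)[OF simple] y w by auto
  then have "card {v, y, w} = 3" using w by simp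
  moreover have "{v, y, w} \<subseteq> verts G" using adjD[OF simple y] adjD[OF simple w(1)] by auto
  ultimately have 3: "3 \<le> card (verts G)" using card_mono[OF finite_V] by metis
  then show "2 < card (verts G)" by simp
  fix X assume X: "X \<subseteq> verts G \<and> card X < 2"
  then have "finite X" using finite_V finite_subset by auto
  then consider "X = {}" | x where "X = {x}" using X by (auto simp: less_2_cases_iff card_1_singleton_iff)
  then show "connected (del_verts G X)"
  proof cases
    case 1
    then have "del_verts G X = G" by (simp add: del_verts_def)
    moreover have "\<exists>a\<in>S. \<exists>b\<in>verts G - S. adj G a b" if "S \<noteq> {}" "S \<subset> verts G" for S
      using bridgelessD[OF simple bridgeless that] unfolding two_darts_def by blast
    ultimately show ?thesis using verts_nonempty connectedI by metis
  next
    case 2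
    have VX: "verts (del_verts G X) = verts G - {x}" using 2 by (simp add: del_verts_def)
    show ?thesis
    proof (rule connectedI)
      show "verts (del_verts G X) \<noteq> {}"
      proof
        assume "verts (del_verts G X) = {}"
        then have "card (verts G) \<le> card {x}" unfolding VX by (intro card_mono) auto
        then show False using 3 by simp
      qed
      fix S assume "S \<noteq> {}" "S \<subset> verts (del_verts G X)"
      moreover have "x \<in> verts G" using X 2 by auto
      ultimately obtain a b where ab: "a \<in> S" "b \<in> verts G - {x} - S" "adj G a b"
        using no_cutvertex[of x S] unfolding VX by auto
      moreover have "a \<noteq> x" "b \<noteq> x" using ab \<open>S \<subset> verts (del_verts G X)\<close> unfolding VX by auto
      ultimately show "\<exists>a\<in>S. \<exists>b\<in>verts (del_verts G X) - S. adj (del_verts G X) a b"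
        unfolding VX using 2 by (intro bexI[of _ a] bexI[of _ b]) (auto simp: adj_def del_verts_def)
    qed
  qed
qed

section \<open>Deleting a vertex of degree two\<close>

lemma neighbourhood_eq: "neighbourhood G v = {u. adj G v u}"
  using adjD(2)[OF simple] by (auto simp: neighbourhood_def adj_def)

lemma no_triangle:
  assumes "adj G u v" "adj G v w" "adj G u w" shows False
  using bipartite_side[OF bipartite] assms by metis

text \<open>A bridge \<open>st\<close> of \<open>G - v\<close> separates \<open>u\<close> from
  \<open>w\<close>, so \<open>{uv, st}\<close> and \<open>{vw, st}\<close> are two-edge cuts of
  \<open>G\<close>. Both are trivial, which forces \<open>s = u\<close> and \<open>t = w\<close>,
  and \<open>u, v, w\<close> form a triangle.\<close>

lemma del_vert_bridgeless:
  assumes v: "v \<in> verts G" and nbrs: "\<And>y. adj G v y \<longleftrightarrow> y = u \<or> y = w" and uw: "u \<noteq> w"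
  shows "bridgeless (del_verts G {v})"
proof -
  let ?H = "del_verts G {v}"
  have VH: "verts ?H = verts G - {v}" by (simp add: del_verts_def)
  have adjH: "adj ?H a b \<longleftrightarrow> adj G a b \<and> a \<noteq> v \<and> b \<noteq> v" for a b
    by (auto simp: adj_def del_verts_def)
  have simpH: "simple_graph ?H" using simple by (auto simp: simple_graph_def del_verts_def)
  have nu: "adj G v u" "adj G v w" using nbrs by auto
  have V: "u \<in> verts G" "w \<in> verts G" "u \<noteq> v" "w \<noteq> v" using adjD[OF simple nu(1)] adjD[OF simple nu(2)] by auto
  show ?thesis
  proof (rule bridgelessI[OF simpH, of w])
    show "w \<in> verts ?H" "verts ?H \<noteq> {w}" using V uw unfolding VH by auto
    fix S assume "S \<noteq> {}" "S \<subseteq> verts ?H - {w}"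
    then have S: "S \<noteq> {}" "S \<subseteq> verts G" "v \<notin> S" "w \<notin> S" unfolding VH by auto
    show "two_darts ?H S (verts ?H - S)"
    proof (rule ccontr)
      assume no2: "\<not> two_darts ?H S (verts ?H - S)"
      have uniq: "a = a' \<and> b = b'" if "a \<in> S" "b \<in> verts G - {v} - S" "a' \<in> S" "b' \<in> verts G - {v} - S"
        "adj G a b" "adj G a' b'" for a b a' b'
        using no2 two_dartsI[of a S b "verts ?H - S" a' b' ?H] that S unfolding VH adjH by auto
      have "S \<subset> verts G - {v}" using S V by auto
      then obtain s t where st: "s \<in> S" "t \<in> verts G - {v} - S" "adj G s t"
        using no_cutvertex[OF v S(1)] by auto
      have "S \<subset> verts G" using S v by auto
      from bridgelessD[OF simple bridgeless S(1) this]
      obtain c d where cd: "c \<in> S" "d \<in> verts G - S" "adj G c d" "(c, d) \<noteq> (s, t)"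
        by (rule two_darts_neq)
      have "d = v" using uniq[of c d s t] cd st by auto
      then have uS: "u \<in> S" using nbrs[of c] cd adj_sym[of G c v] S by auto
      have "\<exists>z\<in>verts G. \<forall>y. adj G z y \<longrightarrow> {z, y} \<in> {{u, v}, {s, t}}"
      proof -
        have F: "cut_edges G S = {{u, v}, {s, t}}"
        proof (intro equalityI subsetI)
          fix e assume "e \<in> cut_edges G S"
          then obtain a b where ab: "a \<in> S" "b \<in> verts G - S" "adj G a b" "e = {a, b}" by (rule cut_edgesE)
          show "e \<in> {{u, v}, {s, t}}"
          proof (cases "b = v")
            case True
            then have "a = u" using nbrs[of a] ab adj_sym[of G a v] S by auto
            then show ?thesis using ab True by simp
          next
            case False
            then show ?thesis using uniq[of a b s t] ab st by auto
          qed
        next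
          fix e assume "e \<in> {{u, v}, {s, t}}"
          then show "e \<in> cut_edges G S"
            using cut_edgesI[of u S v G] cut_edgesI[of s S t G] uS st S v nu adj_sym[of G u v] by auto
        qed
        have "edge_cut G (cut_edges G S)" unfolding edge_cut_def using S(1) \<open>S \<subset> verts G\<close> by blast
        moreover have "{u, v} \<noteq> {s, t}" using st S by (auto simp: doubleton_eq_iff)
        then have "card (cut_edges G S) = 2" unfolding F by simp
        ultimately have "trivial_edge_cut G (cut_edges G S)" by (rule two_edge_cut_trivial)
        then show ?thesis unfolding F by (rule trivial_edge_cutD) auto
      qed
      then obtain z where z: "z \<in> verts G" "\<And>y. adj G z y \<Longrightarrow> {z, y} \<in> {{u, v}, {s, t}}" by auto
      \<comment> \<open>All edges at \<open>z\<close> lie in the cut and there are at least two of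
        them, so \<open>z\<close> is an end of both cut edges. As \<open>v\<close> is not an end of
        \<open>st\<close> and \<open>t\<close> is outside \<open>S\<close>, the common end is
        \<open>u = s\<close>.\<close>
      have us: "u = s"
      proof -
        obtain y where y: "adj G z y" using other_nbr[OF z(1)] .
        obtain y' where y': "adj G z y'" "y' \<noteq> y" using other_nbr[OF z(1)] .
        have "{z, y} \<noteq> {z, y'}" using y' by (auto simp: doubleton_eq_iff)
        then have "z \<in> {u, v} \<and> z \<in> {s, t}" using z(2)[OF y] z(2)[OF y'(1)] by auto
        then show ?thesis using uS st S by auto
      qed
      let ?S' = "insert v S"
      have S': "?S' \<noteq> {}" "?S' \<subset> verts G" using S v V by auto
      have F: "cut_edges G ?S' = {{v, w}, {s, t}}"
      proof (intro equalityI subsetI)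
        fix e assume "e \<in> cut_edges G ?S'"
        then obtain a b where ab: "a \<in> ?S'" "b \<in> verts G - ?S'" "adj G a b" "e = {a, b}" by (rule cut_edgesE)
        show "e \<in> {{v, w}, {s, t}}"
        proof (cases "a = v")
          case True
          then have "b = w" using nbrs[of b] ab uS by auto
          then show ?thesis using ab True by simp
        next
          case False
          then show ?thesis using uniq[of a b s t] ab st by auto
        qed
      next
        fix e assume "e \<in> {{v, w}, {s, t}}"
        then show "e \<in> cut_edges G ?S'"
          using cut_edgesI[of v ?S' w G] cut_edgesI[of s ?S' t G] st S V nu by auto
      qed
      have "edge_cut G (cut_edges G ?S')"
        unfolding edge_cut_def using S' by (intro exI[of _ ?S'] conjI refl)
      moreover have "{v, w} \<noteq> {s, t}" using st S by (auto simp: doubleton_eq_iff)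
      then have "card (cut_edges G ?S') = 2" unfolding F by simp
      ultimately have "trivial_edge_cut G (cut_edges G ?S')" by (rule two_edge_cut_trivial)
      then obtain z' where z': "z' \<in> verts G" "\<And>y. adj G z' y \<Longrightarrow> {z', y} \<in> {{v, w}, {s, t}}"
        unfolding F by (rule trivial_edge_cutD) auto
      have wt: "w = t"
      proof -
        obtain y where y: "adj G z' y" using other_nbr[OF z'(1)] .
        obtain y' where y': "adj G z' y'" "y' \<noteq> y" using other_nbr[OF z'(1)] .
        have "{z', y} \<noteq> {z', y'}" using y' by (auto simp: doubleton_eq_iff)
        then have "z' \<in> {v, w} \<and> z' \<in> {s, t}" using z'(2)[OF y] z'(2)[OF y'(1)] by auto
        then show ?thesis using st S by auto
      qed
      show False using no_triangle[of u v w] nu st(3) us wt adj_sym[of G u v] by auto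
    qed
  qed
qed

text \<open>Colour \<open>p = f w x = f x u\<close> is rerouted along \<open>w, v, u\<close>, and a fresh colour \<open>q\<close> runs
  around the 4-cycle \<open>u, v, w, x\<close>.\<close>

lemma reroute:
  assumes nbrs: "\<And>y. adj G v y \<longleftrightarrow> y = u \<or> y = w" and dist: "u \<noteq> w" "x \<noteq> v"
    and x: "adj G u x" "adj G w x"
    and f: "balanced (edges (del_verts G {v})) f" "f w x = f x u"
  shows False
proof -
  define E0 where "E0 = edges (del_verts G {v})"
  define E1 where "E1 = E0 - {{w, x}, {x, u}}"
  have V: "u \<noteq> v" "w \<noteq> v" "x \<noteq> u" "x \<noteq> w"
    using adjD(3)[OF simple, of v u] adjD(3)[OF simple, of v w] adjD(3)[OF simple x(1)] adjD(3)[OF simple x(2)] nbrs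
    by auto
  have E0mem: "{a, b} \<in> E0 \<longleftrightarrow> adj G a b \<and> a \<noteq> v \<and> b \<noteq> v" for a b
    by (auto simp: E0_def del_verts_def adj_def)
  have in0: "{w, x} \<in> E0" "{x, u} \<in> E0" "{x, w} \<in> E0" "{u, x} \<in> E0"
    using x V dist adj_sym[of G u x] adj_sym[of G w x] unfolding E0mem by auto
  have E0: "E0 = insert {w, x} (insert {x, u} E1)" using in0 by (auto simp: E1_def)
  have EG: "edges G = insert {u, v} (insert {w, v} E0)"
  proof (intro equalityI subsetI)
    fix e assume e: "e \<in> edges G"
    obtain a b where ab: "e = {a, b}" using simple_edgeE[OF simple e] by metis
    then have "adj G a b" "adj G b a" using e by (auto simp: adj_def insert_commute)
    then show "e \<in> insert {u, v} (insert {w, v} E0)"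
      using ab E0mem[of a b] nbrs[of a] nbrs[of b] by (auto simp: insert_commute)
  next
    fix e assume "e \<in> insert {u, v} (insert {w, v} E0)"
    then show "e \<in> edges G" using nbrs[of u] nbrs[of w]
      by (auto simp: E0_def del_verts_def adj_def insert_commute)
  qed
  have fin: "finite E1" "finite E0" using finite_E by (auto simp: E1_def E0_def del_verts_def)
  have notin: "{x, u} \<notin> E1" "{w, x} \<notin> insert {x, u} E1"
    "{w, v} \<notin> E0" "{u, v} \<notin> insert {w, v} E0"
    using V dist E0mem by (auto simp: E1_def doubleton_eq_iff)
  define p where "p = f w x"
  obtain q where q: "q \<notin> colours_used E0 f"
    using ex_new_if_finite[OF infinite_UNIV_nat card_colours_used(1)[OF fin(2)]] by auto
  have used: "f a b \<noteq> q" if "{a, b} \<in> E0" for a b using colours_usedI[OF that, of f] q by auto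
  have pq: "p \<noteq> q" using used[OF in0(1)] by (simp add: p_def)
  define g where "g a b =
    (if (a, b) \<in> {(w, v), (v, u)} then p
     else if (a, b) \<in> {(w, x), (x, u), (u, v), (v, w)} then q else f a b)" for a b
  have g: "g w v = p" "g v u = p" "g w x = q" "g x u = q" "g u v = q" "g v w = q"
    "g x w = f x w" "g u x = f u x"
    using V dist by (auto simp: g_def)
  have g1: "g a b = f a b" if "{a, b} \<in> E1" for a b
    using that notin E0mem by (auto simp: g_def E1_def insert_commute)
  have fne: "f a b \<noteq> f b a" if "{a, b} \<in> E0" for a b
    using f(1) that by (auto simp: balanced_def antiparallel_distinct_def E0_def)
  have "antiparallel_distinct (edges G) g"
    unfolding antiparallel_distinct_def
  proof (intro allI impI)
    fix a b assume "{a, b} \<in> edges G"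
    then consider "{a, b} = {u, v}" | "{a, b} = {w, v}" | "{a, b} = {w, x}" | "{a, b} = {x, u}" | "{a, b} \<in> E1"
      unfolding EG E0 by auto
    then show "g a b \<noteq> g b a"
    proof cases
      case 5
      then have "{b, a} \<in> E1" "{a, b} \<in> E0" by (simp_all add: insert_commute E0)
      then show ?thesis using g1[OF 5] g1[of b a] fne[of a b] by simp
    qed (use g pq used[OF in0(3)] used[OF in0(4)] in \<open>auto simp: doubleton_eq_iff\<close>)
  qed
  moreover have "excess (edges G) g y i = 0" for y i
  proof -
    have ex0: "excess E0 h y i = excess E1 h y i
       + (of_bool (y = u) - of_bool (y = x)) * (of_bool (h x u = i) - of_bool (h u x = i))
       + (of_bool (y = x) - of_bool (y = w)) * (of_bool (h w x = i) - of_bool (h x w = i))" for h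
      unfolding E0
      using excess_insert[OF fin(1) notin(1) V(3), of h y i]
        excess_insert[OF _ notin(2) V(4)[symmetric], of h y i] fin(1) by simp
    have "excess E1 g y i = excess E1 f y i" by (rule excess_cong) (rule g1)
    then have eg: "excess (edges G) g y i = excess E1 f y i
       + (of_bool (y = u) - of_bool (y = x)) * (of_bool (q = i) - of_bool (f u x = i))
       + (of_bool (y = x) - of_bool (y = w)) * (of_bool (q = i) - of_bool (f x w = i))
       + (of_bool (y = v) - of_bool (y = w)) * (of_bool (p = i) - of_bool (q = i))
       + (of_bool (y = v) - of_bool (y = u)) * (of_bool (q = i) - of_bool (p = i))"
      unfolding EG
      using excess_insert[OF fin(2) notin(3) V(2), of g y i]
        excess_insert[OF _ notin(4) V(1), of g y i] fin(2) ex0[of g] g by simp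
    have "excess E0 f y i = 0" using f(1) by (simp add: balanced_def E0_def)
    then have "excess E1 f y i
       + (of_bool (y = u) - of_bool (y = x)) * (of_bool (p = i) - of_bool (f u x = i))
       + (of_bool (y = x) - of_bool (y = w)) * (of_bool (p = i) - of_bool (f x w = i)) = 0"
      unfolding ex0 using f(2) by (simp only: p_def)
    then show ?thesis unfolding eg by algebra
  qed
  ultimately have "balanced (edges G) g" by (simp add: balanced_def)
  then show False using not_balanced by blast
qed

text \<open>In \<open>G - v\<close> the vertex \<open>x\<close> has at most three neighbours, among
  them \<open>u\<close> and \<open>w\<close>. Balance at \<open>x\<close>, with different colours on
  opposite darts, then makes some colour pass through \<open>x\<close> from \<open>u\<close> to
  \<open>w\<close> or back, and \<open>reroute\<close> applies up to exchanging \<open>u\<close> and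
  \<open>w\<close>.\<close>

lemma no_four_cycle:
  assumes nbrs: "\<And>y. adj G v y \<longleftrightarrow> y = u \<or> y = w" and dist: "u \<noteq> w" "x \<noteq> v"
    and x: "adj G u x" "adj G w x"
  shows False
proof -
  let ?H = "del_verts G {v}"
  have vu: "adj G v u" "adj G v w" using nbrs by auto
  have V: "v \<in> verts G" "x \<in> verts G" "u \<noteq> v" "w \<noteq> v"
    using adjD[OF simple vu(1)] adjD[OF simple vu(2)] adjD[OF simple x(1)] by auto
  have simpH: "simple_graph ?H" using simple by (auto simp: simple_graph_def del_verts_def)
  obtain A where A: "\<And>u v. adj G u v \<Longrightarrow> u \<in> A \<longleftrightarrow> v \<notin> A"
    using bipartite_side[OF bipartite] by metis
  have "adj G a b" if "adj ?H a b" for a b using that by (simp add: adj_def del_verts_def)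
  then have "bipartite ?H" using A by (intro bipartite_sideI[OF simpH, of A]) simp
  moreover have "card (edges ?H) < card (edges G)"
    using vu(1) by (intro psubset_card_mono finite_E) (auto simp: del_verts_def adj_def)
  ultimately obtain f where f: "balanced (edges ?H) f"
    using smaller_balanced[OF simpH del_vert_bridgeless[OF V(1) nbrs dist(1)]] by blast
  let ?N = "{y. {y, x} \<in> edges ?H}"
  have mem: "{y, x} \<in> edges ?H \<longleftrightarrow> adj G y x \<and> y \<noteq> v" for y
    using dist by (auto simp: adj_def del_verts_def)
  have fN: "finite ?N" by (rule finite_nbrs[OF finite_edges[OF simpH]])
  have "card ?N \<le> card {y. {y, x} \<in> edges G}"
    by (intro card_mono finite_nbrs finite_E) (auto simp: del_verts_def)
  then have N3: "card ?N \<le> 3" using degree_le_3[OF V(2)] degree_eq_card_nbrs[OF simple] by simp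
  have sub: "{u, w} \<subseteq> ?N" using x V unfolding mem by auto
  have ex: "(\<Sum>y\<in>?N. of_bool (f y x = i) - of_bool (f x y = i)) = (0 :: int)" for i
    using f by (simp add: balanced_def excess_def)
  have ne: "f y x \<noteq> f x y" if "y \<in> ?N" for y
    using f that by (auto simp: balanced_def antiparallel_distinct_def)
  have "card (?N - {u, w}) \<le> 1"
    using N3 sub dist(1) fN by (simp add: card_Diff_subset)
  then consider "card (?N - {u, w}) = 0" | "card (?N - {u, w}) = 1" by linarith
  then have "f u x = f x w \<or> f w x = f x u"
  proof cases
    case 1
    then have "?N - {u, w} = {}" using fN by simp
    then have N: "?N = {u, w}" using sub by blast
    have "of_bool (f u x = f u x) - of_bool (f x u = f u x)
       + (of_bool (f w x = f u x) - of_bool (f x w = f u x)) = (0 :: int)"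
      using ex[of "f u x"] dist(1) unfolding N by simp
    moreover have "f u x \<noteq> f x u" using ne[of u] sub by simp
    ultimately show ?thesis by (cases "f x w = f u x") (auto simp: of_bool_def split: if_splits)
  next
    case 2
    then obtain r where r: "?N - {u, w} = {r}" by (rule card_1_singletonE)
    then have N: "?N = {u, w, r}" and ru: "r \<noteq> u" "r \<noteq> w" using sub by blast+
    have n: "f u x \<noteq> f x u" "f w x \<noteq> f x w" "f r x \<noteq> f x r" using ne unfolding N by blast+
    have "of_bool (f u x = i) - of_bool (f x u = i) + (of_bool (f w x = i) - of_bool (f x w = i))
      + (of_bool (f r x = i) - of_bool (f x r = i)) = (0 :: int)" for i
      using ex[of i] dist(1) ru unfolding N by simp
    with n show ?thesis by (rule derangement_of_three)
  qed
  then show False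
  proof
    assume "f w x = f x u"
    then show False by (rule reroute[OF nbrs dist x f])
  next
    assume "f u x = f x w"
    moreover have "adj G v y \<longleftrightarrow> y = w \<or> y = u" for y using nbrs by auto
    ultimately show False using reroute[of v w u x f] dist x f by auto
  qed
qed

end

theorem theorem3p1:
  fixes G :: "'a ugraph"
  assumes "extremal_noncolorable G"
  shows "k_connected 2 G
    \<and> (min_degree G = 2 \<and> max_degree G = 3)
    \<and> \<not> (\<exists>F. edge_cut G F \<and> card F = 2 \<and> \<not> trivial_edge_cut G F)
    \<and> (\<forall>v\<in>verts G. degree G v = 2 \<longrightarrow> bridgeless (del_verts G {v}))
    \<and> (\<forall>v\<in>verts G. \<forall>u w. neighbourhood G v = {u, w} \<longrightarrow>
          neighbourhood G u \<inter> neighbourhood G w = {v})"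
proof -
  interpret extremal G by unfold_locales (rule assms)
  have "bridgeless (del_verts G {v})" if v: "v \<in> verts G" "degree G v = 2" for v
  proof -
    have "card {u. adj G v u} = 2"
      using v(2) degree_eq_card_nbrs[OF simple, of v] by (simp add: adj_def insert_commute)
    then obtain u w where uw: "{u. adj G v u} = {u, w}" "u \<noteq> w" by (auto simp: card_2_iff)
    then have "adj G v y \<longleftrightarrow> y = u \<or> y = w" for y by auto
    then show ?thesis using uw(2) by (rule del_vert_bridgeless[OF v(1)])
  qed
  moreover have "neighbourhood G u \<inter> neighbourhood G w = {v}"
    if v: "v \<in> verts G" "neighbourhood G v = {u, w}" for u v w
  proof -
    have nbrs: "adj G v y \<longleftrightarrow> y = u \<or> y = w" for y using v(2) unfolding neighbourhood_eq by auto
    \<comment> \<open>The notation \<open>{u, w}\<close> would also cover a single neighbour, which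
      bridgelessness rules out.\<close>
    have "u \<noteq> w"
    proof
      assume "u = w"
      obtain y where "adj G v y" "y \<noteq> u" using other_nbr[OF v(1)] .
      then show False using nbrs \<open>u = w\<close> by auto
    qed
    show ?thesis
      unfolding neighbourhood_eq
    proof (intro equalityI subsetI)
      fix x assume "x \<in> {x. adj G u x} \<inter> {x. adj G w x}"
      then show "x \<in> {v}" using no_four_cycle[OF nbrs \<open>u \<noteq> w\<close>, of x] by auto
    next
      fix x assume "x \<in> {v}"
      then show "x \<in> {x. adj G u x} \<inter> {x. adj G w x}" using nbrs adj_sym[of G v] by auto
    qed
  qed
  ultimately show ?thesis
    using two_connected min_degree_eq max_degree_eq two_edge_cut_trivial by blast
qed

end
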